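(* Let $K$ be a field and let $\mathcal{C}$ be a finite, non-empty, weakly connected collection of cells in $\mathbb{Z}^2$, with adjacent $2$-minor ideal $I_{\mathrm{adj}}(\mathcal{C})\subset S_{\mathcal{C}}=K[x_v\mid v\in V(\mathcal{C})]$. If $I_{\mathrm{adj}}(\mathcal{C})$ satisfies the following equivalent conditions: (1) $I_{\mathrm{adj}}(\mathcal{C})$ is a complete intersection; (2) $S_{\mathcal{C}}/I_{\mathrm{adj}}(\mathcal{C})$ is Gorenstein; (3) $S_{\mathcal{C}}/I_{\mathrm{adj}}(\mathcal{C})$ is level; (4) $S_{\mathcal{C}}/I_{\mathrm{adj}}(\mathcal{C})$ is Cohen--Macaulay; (5) $I_{\mathrm{adj}}(\mathcal{C})$ is unmixed; then $\mathcal{C}$ does not contain a square tetromino.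
   Context: A cell of $\mathbb{Z}^2$ is a set $C=[a,b]=\{a,b,c,d\}$ with $a=(i,j)$, $b=a+(1,1)$, $c=(i,j+1)$, $d=(i+1,j)$; $a,b$ are its diagonal corners, $c,d$ its anti-diagonal corners, $V(C)=\{a,b,c,d\}$ its vertices, and $\{a,c\},\{c,b\},\{b,d\},\{a,d\}$ its edges. For a set $\mathcal{C}$ of cells, $V(\mathcal{C})=\bigcup_{C\in\mathcal{C}}V(C)$. $\mathcal{C}$ is weakly connected if any two cells of $\mathcal{C}$ can be joined by a sequence of cells of $\mathcal{C}$ in which consecutive cells share an edge or a vertex. $I_{\mathrm{adj}}(\mathcal{C})$ is the ideal of $S_{\mathcal{C}}$ generated by the adjacent $2$-minors $x_ax_b-x_cx_d$, one for each cell of $\mathcal{C}$ (with diagonal corners $a,b$ and anti-diagonal corners $c,d$). A square tetromino is a set of four cells forming a $2\times 2$ block (the four cells containing a given point of $\mathbb{Z}^2$ as a vertex); $\mathcal{C}$ contains it if these four cells all belong to $\mathcal{C}$. An ideal is called unmixed if all its minimal primes have the same height. A standard graded Cohen--Macaulay $K$-algebra is level if its canonical module is generated in a single degree. The five listed conditions are equivalent for every weakly connected collection of cells. *)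

theory Defs
  imports
    "HOL-Algebra.QuotRing"
    "HOL-Algebra.Module"
    "HOL-Library.Poly_Mapping"
    "HOL-Library.Extended_Nat"
begin

section \<open>Collections of cells\<close>

type_synonym point = "int \<times> int"

text \<open>A cell is identified with the set of its four vertices, so that the vertex set of a
  collection of cells is its union.\<close>

definition cell :: "int \<Rightarrow> int \<Rightarrow> point set" where
  "cell i j = {(i, j), (i + 1, j + 1), (i, j + 1), (i + 1, j)}"

definition is_cell :: "point set \<Rightarrow> bool" where
  "is_cell C \<longleftrightarrow> (\<exists>i j. C = cell i j)"

definition cell_edges :: "point set \<Rightarrow> point set set" where
  "cell_edges C = {e. \<exists>i j. C = cell i j \<and>
     e \<in> {{(i, j), (i, j + 1)}, {(i, j + 1), (i + 1, j + 1)},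
          {(i + 1, j + 1), (i + 1, j)}, {(i, j), (i + 1, j)}}}"

definition vertices :: "point set set \<Rightarrow> point set" where
  "vertices \<C> = \<Union> \<C>"

definition share_edge_or_vertex :: "point set \<Rightarrow> point set \<Rightarrow> bool" where
  "share_edge_or_vertex C D \<longleftrightarrow> cell_edges C \<inter> cell_edges D \<noteq> {} \<or> C \<inter> D \<noteq> {}"

definition weakly_connected :: "point set set \<Rightarrow> bool" where
  "weakly_connected \<C> \<longleftrightarrow>
     (\<forall>C\<in>\<C>. \<forall>D\<in>\<C>. \<exists>Cs. Cs \<noteq> [] \<and> set Cs \<subseteq> \<C> \<and> hd Cs = C \<and> last Cs = D \<and>
        successively share_edge_or_vertex Cs)"

definition square_tetromino :: "point set set \<Rightarrow> bool" where
  "square_tetromino T \<longleftrightarrow> (\<exists>v. T = {C. is_cell C \<and> v \<in> C})"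


section \<open>Polynomial rings and adjacent 2-minor ideals\<close>

text \<open>Polynomials in variables indexed by all points of the plane; the ring \<open>K[x\<^sub>v | v \<in> V]\<close> is
  the subring of those polynomials that only involve variables indexed by \<open>V\<close>.\<close>

type_synonym 'k mpoly = "(point \<Rightarrow>\<^sub>0 nat) \<Rightarrow>\<^sub>0 'k"

definition pvar :: "point \<Rightarrow> 'k::field mpoly" where
  "pvar v = Poly_Mapping.single (Poly_Mapping.single v 1) 1"

definition poly_vars :: "'k::field mpoly \<Rightarrow> point set" where
  "poly_vars p = (\<Union>m\<in>Poly_Mapping.keys p. Poly_Mapping.keys m)"

definition poly_ring :: "point set \<Rightarrow> 'k::field mpoly ring" where
  "poly_ring V = \<lparr>carrier = {p. poly_vars p \<subseteq> V}, mult = (*), one = 1, zero = 0, add = (+)\<rparr>"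

definition mon_degree :: "(point \<Rightarrow>\<^sub>0 nat) \<Rightarrow> nat" where
  "mon_degree m = (\<Sum>v\<in>Poly_Mapping.keys m. Poly_Mapping.lookup m v)"

text \<open>Degrees are integers because of the degree shifts below; the components of negative degree
  are zero.\<close>

definition homogeneous_part :: "point set \<Rightarrow> int \<Rightarrow> 'k::field mpoly set" where
  "homogeneous_part V d =
     {p \<in> carrier (poly_ring V). \<forall>m\<in>Poly_Mapping.keys p. int (mon_degree m) = d}"

definition adj_minor :: "int \<Rightarrow> int \<Rightarrow> 'k::field mpoly" where
  "adj_minor i j = pvar (i, j) * pvar (i + 1, j + 1) - pvar (i, j + 1) * pvar (i + 1, j)"

definition adj_ideal :: "point set set \<Rightarrow> 'k::field mpoly set" where
  "adj_ideal \<C> =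
     genideal (poly_ring (vertices \<C>)) {f. \<exists>i j. cell i j \<in> \<C> \<and> f = adj_minor i j}"


section \<open>Heights, dimension, regular sequences\<close>

definition prime_chain :: "('a, 'm) ring_scheme \<Rightarrow> nat \<Rightarrow> (nat \<Rightarrow> 'a set) \<Rightarrow> bool" where
  "prime_chain R n Q \<longleftrightarrow> (\<forall>i\<le>n. primeideal (Q i) R) \<and> (\<forall>i<n. Q i \<subset> Q (Suc i))"

definition prime_height :: "('a, 'm) ring_scheme \<Rightarrow> 'a set \<Rightarrow> enat" where
  "prime_height R P = Sup {enat n | n. \<exists>Q. prime_chain R n Q \<and> Q n = P}"

definition krull_dim :: "('a, 'm) ring_scheme \<Rightarrow> enat" where
  "krull_dim R = Sup {enat n | n. \<exists>Q. prime_chain R n Q}"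

definition minimal_prime :: "('a, 'm) ring_scheme \<Rightarrow> 'a set \<Rightarrow> 'a set \<Rightarrow> bool" where
  "minimal_prime R I P \<longleftrightarrow> primeideal P R \<and> I \<subseteq> P \<and>
     (\<forall>Q. primeideal Q R \<longrightarrow> I \<subseteq> Q \<longrightarrow> Q \<subseteq> P \<longrightarrow> Q = P)"

definition unmixed :: "('a, 'm) ring_scheme \<Rightarrow> 'a set \<Rightarrow> bool" where
  "unmixed R I \<longleftrightarrow>
     (\<forall>P Q. minimal_prime R I P \<longrightarrow> minimal_prime R I Q \<longrightarrow> prime_height R P = prime_height R Q)"

definition regular_sequence :: "('a, 'm) ring_scheme \<Rightarrow> 'a list \<Rightarrow> bool" where
  "regular_sequence R fs \<longleftrightarrow> set fs \<subseteq> carrier R \<and> genideal R (set fs) \<noteq> carrier R \<and>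
     (\<forall>i<length fs. \<forall>g\<in>carrier R.
        fs ! i \<otimes>\<^bsub>R\<^esub> g \<in> genideal R (set (take i fs)) \<longrightarrow> g \<in> genideal R (set (take i fs)))"

definition complete_intersection :: "('a, 'm) ring_scheme \<Rightarrow> 'a set \<Rightarrow> bool" where
  "complete_intersection R I \<longleftrightarrow> (\<exists>fs. regular_sequence R fs \<and> I = genideal R (set fs))"


section \<open>Cohen--Macaulay quotients\<close>

text \<open>Throughout, \<open>I\<close> is a homogeneous ideal of \<open>S = K[x\<^sub>v | v \<in> V]\<close> with \<open>V\<close> finite.\<close>

definition quotient_part :: "point set \<Rightarrow> 'k::field mpoly set \<Rightarrow> int \<Rightarrow> 'k mpoly set set" where
  "quotient_part V I d = (\<lambda>f. I +>\<^bsub>poly_ring V\<^esub> f) ` homogeneous_part V d"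

definition graded_depth :: "point set \<Rightarrow> 'k::field mpoly set \<Rightarrow> enat" where
  "graded_depth V I = Sup {enat (length fs) | fs.
     regular_sequence (poly_ring V Quot I) fs \<and> set fs \<subseteq> (\<Union>d\<in>{0<..}. quotient_part V I d)}"

definition cohen_macaulay :: "point set \<Rightarrow> 'k::field mpoly set \<Rightarrow> bool" where
  "cohen_macaulay V I \<longleftrightarrow> graded_depth V I = krull_dim (poly_ring V Quot I)"


section \<open>Graded free resolutions and the canonical module\<close>

text \<open>The free module \<open>S\<^sup>n\<close> consists of the functions \<open>nat \<Rightarrow> S\<close> that vanish outside
  \<open>{..<n}\<close>.\<close>

definition free_module ::
  "point set \<Rightarrow> nat \<Rightarrow> ('k::field mpoly, nat \<Rightarrow> 'k mpoly) module" where
  "free_module V n =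
     \<lparr>carrier = {v. (\<forall>i<n. v i \<in> carrier (poly_ring V)) \<and> (\<forall>i\<ge>n. v i = 0)},
      mult = undefined, one = undefined, zero = (\<lambda>_. 0), add = (\<lambda>v w i. v i + w i),
      smult = (\<lambda>r v i. r * v i)\<rparr>"

definition mat_app ::
  "nat \<Rightarrow> nat \<Rightarrow> (nat \<Rightarrow> nat \<Rightarrow> 'k::field mpoly) \<Rightarrow> (nat \<Rightarrow> 'k mpoly) \<Rightarrow> nat \<Rightarrow> 'k mpoly" where
  "mat_app m n A v = (\<lambda>r. if r < m then \<Sum>c<n. A r c * v c else 0)"

definition mat_transpose :: "(nat \<Rightarrow> nat \<Rightarrow> 'a) \<Rightarrow> nat \<Rightarrow> nat \<Rightarrow> 'a" where
  "mat_transpose A = (\<lambda>r c. A c r)"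

text \<open>\<open>F\<^sub>i\<close> is the direct sum of the \<open>S(-shft F i j)\<close>, \<open>j < rk F i\<close>, and \<open>diff F i\<close> is the matrix
  of the map \<open>F\<^sub>i\<^sub>+\<^sub>1 \<rightarrow> F\<^sub>i\<close>.\<close>

record (overloaded) 'k free_complex =
  rk :: "nat \<Rightarrow> nat"
  shft :: "nat \<Rightarrow> nat \<Rightarrow> int"
  diff :: "nat \<Rightarrow> nat \<Rightarrow> nat \<Rightarrow> 'k mpoly"

definition diff_image :: "point set \<Rightarrow> 'k::field free_complex \<Rightarrow> nat \<Rightarrow> (nat \<Rightarrow> 'k mpoly) set" where
  "diff_image V F i =
     mat_app (rk F i) (rk F (Suc i)) (diff F i) ` carrier (free_module V (rk F (Suc i)))"

definition diff_kernel :: "point set \<Rightarrow> 'k::field free_complex \<Rightarrow> nat \<Rightarrow> (nat \<Rightarrow> 'k mpoly) set" where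
  "diff_kernel V F i =
     {v \<in> carrier (free_module V (rk F (Suc i))).
        mat_app (rk F i) (rk F (Suc i)) (diff F i) v = (\<lambda>_. 0)}"

definition graded_free_resolution ::
  "point set \<Rightarrow> 'k::field mpoly set \<Rightarrow> 'k free_complex \<Rightarrow> bool" where
  "graded_free_resolution V I F \<longleftrightarrow>
     rk F 0 = 1 \<and> shft F 0 0 = 0 \<and>
     (\<forall>i. \<forall>r<rk F i. \<forall>c<rk F (Suc i).
        diff F i r c \<in> homogeneous_part V (shft F (Suc i) c - shft F i r)) \<and>
     (\<lambda>v. v 0) ` diff_image V F 0 = I \<and>
     (\<forall>i. diff_kernel V F i = diff_image V F (Suc i))"

text \<open>Cocycles and coboundaries of the dual complex \<open>Hom(F, S)\<close>; its maps are the transposed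
  matrices.\<close>

definition cocycles :: "point set \<Rightarrow> 'k::field free_complex \<Rightarrow> nat \<Rightarrow> (nat \<Rightarrow> 'k mpoly) set" where
  "cocycles V F i =
     {v \<in> carrier (free_module V (rk F i)).
        mat_app (rk F (Suc i)) (rk F i) (mat_transpose (diff F i)) v = (\<lambda>_. 0)}"

definition coboundaries :: "point set \<Rightarrow> 'k::field free_complex \<Rightarrow> nat \<Rightarrow> (nat \<Rightarrow> 'k mpoly) set" where
  "coboundaries V F i = (case i of 0 \<Rightarrow> {\<lambda>_. 0}
     | Suc k \<Rightarrow> mat_app (rk F (Suc k)) (rk F k) (mat_transpose (diff F k)) `
                  carrier (free_module V (rk F k)))"

definition quotient_module :: "('a, 'b, 'm) module_scheme \<Rightarrow> 'b set \<Rightarrow> ('a, 'b set) module" where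
  "quotient_module M N =
     \<lparr>carrier = a_rcosets\<^bsub>M\<^esub> N, mult = undefined, one = undefined, zero = N, add = set_add M,
      smult = (\<lambda>r A. \<Union>a\<in>A. N +>\<^bsub>M\<^esub> (r \<odot>\<^bsub>M\<^esub> a))\<rparr>"

definition ext_module ::
  "point set \<Rightarrow> 'k::field free_complex \<Rightarrow> nat \<Rightarrow> ('k mpoly, (nat \<Rightarrow> 'k mpoly) set) module" where
  "ext_module V F i =
     quotient_module ((free_module V (rk F i))\<lparr>carrier := cocycles V F i\<rparr>) (coboundaries V F i)"

text \<open>For a graded free resolution \<open>F\<close> of a Cohen--Macaulay ring \<open>S/I\<close> of dimension \<open>d\<close>, the
  canonical module is the graded module \<open>Ext\<^bsup>n-d\<^esup>(S/I, S(-n))\<close> over \<open>S\<close>, where \<open>n = card V\<close>. The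
  \<open>i\<close>-th term of \<open>Hom(F, S(-n))\<close> is the direct sum of the \<open>S(shft F i j - n)\<close>.\<close>

definition codim :: "point set \<Rightarrow> 'k::field mpoly set \<Rightarrow> nat" where
  "codim V I = card V - the_enat (krull_dim (poly_ring V Quot I))"

definition canonical_module ::
  "point set \<Rightarrow> 'k::field mpoly set \<Rightarrow> 'k free_complex
     \<Rightarrow> ('k mpoly, (nat \<Rightarrow> 'k mpoly) set) module" where
  "canonical_module V I F = ext_module V F (codim V I)"

definition canonical_part ::
  "point set \<Rightarrow> 'k::field mpoly set \<Rightarrow> 'k free_complex \<Rightarrow> int \<Rightarrow> (nat \<Rightarrow> 'k mpoly) set set" where
  "canonical_part V I F e =
     (\<lambda>v. coboundaries V F (codim V I) +>\<^bsub>free_module V (rk F (codim V I))\<^esub> v) `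
       {v \<in> cocycles V F (codim V I). \<forall>j<rk F (codim V I).
          v j \<in> homogeneous_part V (e + shft F (codim V I) j - int (card V))}"


section \<open>Level and Gorenstein quotients\<close>

definition generates_module ::
  "('a, 'm) ring_scheme \<Rightarrow> ('a, 'b) module \<Rightarrow> 'b set \<Rightarrow> bool" where
  "generates_module R M G \<longleftrightarrow>
     G \<subseteq> carrier M \<and> (\<forall>N. submodule N R M \<longrightarrow> G \<subseteq> N \<longrightarrow> N = carrier M)"

definition level :: "point set \<Rightarrow> 'k::field mpoly set \<Rightarrow> bool" where
  "level V I \<longleftrightarrow> cohen_macaulay V I \<and>
     (\<exists>F e. graded_free_resolution V I F \<and>
        generates_module (poly_ring V) (canonical_module V I F) (canonical_part V I F e))"

text \<open>A Cohen--Macaulay standard graded algebra \<open>R = S/I\<close> is Gorenstein if its canonical module is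
  isomorphic, as a graded module, to \<open>R(a)\<close> for some integer \<open>a\<close>.\<close>

definition gorenstein :: "point set \<Rightarrow> 'k::field mpoly set \<Rightarrow> bool" where
  "gorenstein V I \<longleftrightarrow> cohen_macaulay V I \<and>
     (\<exists>F a h. graded_free_resolution V I F \<and>
        (let S = poly_ring V; R = S Quot I; \<omega> = canonical_module V I F in
          bij_betw h (carrier R) (carrier \<omega>) \<and>
          (\<forall>x\<in>carrier R. \<forall>y\<in>carrier R. h (x \<oplus>\<^bsub>R\<^esub> y) = h x \<oplus>\<^bsub>\<omega>\<^esub> h y) \<and>
          (\<forall>s\<in>carrier S. \<forall>x\<in>carrier R. h ((I +>\<^bsub>S\<^esub> s) \<otimes>\<^bsub>R\<^esub> x) = s \<odot>\<^bsub>\<omega>\<^esub> h x) \<and>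
          (\<forall>d. h ` quotient_part V I d \<subseteq> canonical_part V I F (d - a))))"

end

theory Submission
  imports Defs "HOL-Library.Product_Lexorder" "HOL-Computational_Algebra.Fraction_Field"
begin

text \<open>Let \<open>V\<close> be the set of vertices and \<open>D\<close> the set of cells. The proof only uses primes given by
  parametrizations and the following growth argument. Call
  \<open>g\<^sub>1, \<dots>, g\<^sub>n\<close> independent modulo an ideal \<open>J\<close> if no nontrivial polynomial in them with
  coefficients in \<open>K\<close> lies in \<open>J\<close>. If \<open>J \<subseteq> P\<close>, \<open>f \<in> P\<close> is regular modulo \<open>J\<close> and \<open>gs\<close> are
  independent modulo \<open>P\<close>, then \<open>f, gs\<close> are independent modulo \<open>J\<close>; and modulo \<open>0\<close> there are
  at most \<open>card V\<close> independent elements.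

  Solving the minor of each cell for its upper right corner parametrizes a minimal prime \<open>P\<close> of
  \<open>I\<close> that contains no monomial and has height at least \<open>card D\<close>. If there is
  a square tetromino, setting to zero a vertical run of vertices through its centre kills more
  minors than variables; this gives a prime \<open>Q \<supseteq> I\<close> modulo which more than
  \<open>card V - card D\<close> variables are independent. Hence \<open>Q\<close> has height less than \<open>card D\<close>, and \<open>I\<close> is
  not unmixed. A regular sequence generating \<open>I\<close> would have length less than \<open>card D\<close>, but the
  minors are \<open>card D\<close> linearly independent quadrics. A homogeneous regular sequence on \<open>S/I\<close> is
  independent modulo \<open>P\<close>, so the depth is at most \<open>card V - card D\<close>, while specializing the free
  variables of \<open>Q\<close> one by one shows that the dimension is larger.\<close>

section \<open>Polynomials and ideals of \<open>poly_ring V\<close>\<close>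

definition Const :: "'k::field \<Rightarrow> 'k mpoly" where
  "Const c = Poly_Mapping.single 0 c"

lemma Const_0 [simp]: "Const 0 = 0" and Const_1 [simp]: "Const 1 = 1"
  and Const_add: "Const (a + b) = Const a + Const b"
  and Const_mult: "Const (a * b) = Const a * Const b"
  by (simp_all add: Const_def single_add mult_single)

abbreviation polys :: "point set \<Rightarrow> 'k::field mpoly set" where
  "polys V \<equiv> carrier (poly_ring V)"

lemma poly_ring_simps [simp]:
  "mult (poly_ring V) = (*)" "one (poly_ring V) = 1" "zero (poly_ring V) = 0"
  "add (poly_ring V) = (+)"
  by (simp_all add: poly_ring_def)

lemma polys_iff: "p \<in> polys V \<longleftrightarrow> (\<forall>m\<in>Poly_Mapping.keys p. Poly_Mapping.keys m \<subseteq> V)"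
  by (auto simp: poly_ring_def poly_vars_def)

lemma polys_zero [simp]: "0 \<in> polys V"
  and polys_one [simp]: "1 \<in> polys V"
  and polys_Const [simp]: "Const c \<in> polys V"
  by (auto simp: polys_iff Const_def)

lemma polys_add [simp]: "p \<in> polys V \<Longrightarrow> q \<in> polys V \<Longrightarrow> p + q \<in> polys V"
  using Poly_Mapping.keys_add[of p q] by (auto simp: polys_iff)

lemma polys_uminus [simp]: "p \<in> polys V \<Longrightarrow> - p \<in> polys V" for p :: "'k::field mpoly"
  by (simp add: polys_iff in_keys_iff)

lemma polys_diff [simp]: "p \<in> polys V \<Longrightarrow> q \<in> polys V \<Longrightarrow> p - q \<in> polys V"
  using polys_add[of p V "- q"] by simp

lemma keys_add_nat: "Poly_Mapping.keys (m + n) = Poly_Mapping.keys m \<union> Poly_Mapping.keys n"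
  for m n :: "'a \<Rightarrow>\<^sub>0 nat"
  by (auto simp: in_keys_iff lookup_add)

lemma polys_mult [simp]: "p \<in> polys V \<Longrightarrow> q \<in> polys V \<Longrightarrow> p * q \<in> polys V"
  using Poly_Mapping.keys_mult[of p q] by (fastforce simp: polys_iff keys_add_nat)

lemma polys_sum: "(\<And>i. i \<in> A \<Longrightarrow> f i \<in> polys V) \<Longrightarrow> sum f A \<in> polys V"
  by (induction A rule: infinite_finite_induct) auto

lemma polys_power: "p \<in> polys V \<Longrightarrow> p ^ n \<in> polys V"
  by (induction n) auto

lemma polys_single: "Poly_Mapping.keys m \<subseteq> V \<Longrightarrow> Poly_Mapping.single m c \<in> polys V"
  by (auto simp: polys_iff)

lemma polys_pvar [simp]: "pvar v \<in> polys V \<longleftrightarrow> v \<in> V"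
  by (auto simp: polys_iff pvar_def)

lemma polys_mono: "V \<subseteq> W \<Longrightarrow> p \<in> polys V \<Longrightarrow> p \<in> polys W"
  by (auto simp: polys_iff)

lemma poly_ring_cring: "cring (poly_ring V :: 'k::field mpoly ring)"
proof (rule cringI)
  have "\<exists>y. y \<in> polys V \<and> y + x = 0 \<and> x + y = 0" if "x \<in> polys V" for x :: "'k mpoly"
    using that by (intro exI[of _ "- x"]) auto
  then show "abelian_group (poly_ring V :: 'k mpoly ring)"
    by (intro abelian_groupI) (auto simp: algebra_simps)
  show "Group.comm_monoid (poly_ring V :: 'k mpoly ring)"
    by (rule comm_monoidI) (auto simp: algebra_simps)
qed (auto simp: algebra_simps)

lemma poly_ring_ring: "ring (poly_ring V :: 'k::field mpoly ring)"
  using poly_ring_cring cring.axioms(1) by blast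

lemma poly_ring_a_inv [simp]:
  assumes "p \<in> polys V" shows "a_inv (poly_ring V) p = - p"
proof -
  interpret cring "poly_ring V" by (rule poly_ring_cring)
  show ?thesis using minus_equality[of "- p" p] assms by simp
qed

section \<open>Ideals, prime ideals and generated ideals in terms of explicit closure
  properties\<close>

definition poly_ideal :: "point set \<Rightarrow> 'k::field mpoly set \<Rightarrow> bool" where
  "poly_ideal V J \<longleftrightarrow> J \<subseteq> polys V \<and> 0 \<in> J \<and> (\<forall>p\<in>J. \<forall>q\<in>J. p + q \<in> J) \<and>
     (\<forall>r\<in>polys V. \<forall>p\<in>J. r * p \<in> J)"

lemma poly_idealD:
  assumes "poly_ideal V J"
  shows "p \<in> J \<Longrightarrow> p \<in> polys V" "0 \<in> J" "p \<in> J \<Longrightarrow> q \<in> J \<Longrightarrow> p + q \<in> J"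
    "r \<in> polys V \<Longrightarrow> p \<in> J \<Longrightarrow> r * p \<in> J" "r \<in> polys V \<Longrightarrow> p \<in> J \<Longrightarrow> p * r \<in> J"
  using assms by (auto simp: poly_ideal_def mult.commute)

lemma poly_ideal_uminus: "poly_ideal V J \<Longrightarrow> p \<in> J \<Longrightarrow> - p \<in> J"
  using poly_idealD(4)[of V J "- 1" p] by simp

lemma poly_ideal_diff: "poly_ideal V J \<Longrightarrow> p \<in> J \<Longrightarrow> q \<in> J \<Longrightarrow> p - q \<in> J"
  using poly_idealD(3)[of V J p "- q"] poly_ideal_uminus by auto

lemma poly_ideal_add_cancel: "poly_ideal V J \<Longrightarrow> p + q \<in> J \<Longrightarrow> q \<in> J \<Longrightarrow> p \<in> J"
  using poly_ideal_diff[of V J "p + q" q] by simp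

lemma poly_ideal_cong:
  "poly_ideal V J \<Longrightarrow> p - q \<in> J \<Longrightarrow> p \<in> J \<longleftrightarrow> q \<in> J"
  using poly_idealD(3)[of V J "p - q" q] poly_ideal_diff[of V J p "p - q"] by auto

lemma ideal_iff_poly_ideal: "ideal J (poly_ring V) \<longleftrightarrow> poly_ideal V J" for J :: "'k::field mpoly set"
proof
  assume "ideal J (poly_ring V)"
  then interpret ideal J "poly_ring V" .
  show "poly_ideal V J"
    unfolding poly_ideal_def
    using a_subset additive_subgroup.zero_closed[OF is_additive_subgroup]
      additive_subgroup.a_closed[OF is_additive_subgroup] I_l_closed by auto
next
  assume J: "poly_ideal V J"
  show "ideal J (poly_ring V)"
  proof (rule idealI[OF poly_ring_ring])
    interpret cring "poly_ring V :: 'k mpoly ring" by (rule poly_ring_cring)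
    show "subgroup J (add_monoid (poly_ring V))"
    proof (rule add.subgroupI)
      show "J \<noteq> {}" using poly_idealD(2)[OF J] by auto
    qed (use J in \<open>auto simp: poly_idealD poly_ideal_uminus simp flip: a_inv_def\<close>)
  qed (use J in \<open>auto simp: poly_idealD\<close>)
qed

lemma primeideal_iff:
  "primeideal Q (poly_ring V) \<longleftrightarrow> poly_ideal V Q \<and> 1 \<notin> Q \<and>
     (\<forall>p\<in>polys V. \<forall>q\<in>polys V. p * q \<in> Q \<longrightarrow> p \<in> Q \<or> q \<in> Q)" (is "?l \<longleftrightarrow> ?r")
  for Q :: "'k::field mpoly set"
proof
  assume ?l
  then interpret primeideal Q "poly_ring V" .
  have "1 \<notin> Q" using one_imp_carrier I_notcarr by auto
  then show ?r using is_ideal I_prime by (auto simp: ideal_iff_poly_ideal)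
next
  assume r: ?r
  show ?l
  proof (rule primeidealI)
    show "polys V \<noteq> Q" using r polys_one by blast
  qed (use r in \<open>auto simp: ideal_iff_poly_ideal poly_ring_cring\<close>)
qed

abbreviation gen :: "point set \<Rightarrow> 'k::field mpoly set \<Rightarrow> 'k mpoly set" where
  "gen V A \<equiv> genideal (poly_ring V) A"

lemma poly_ideal_gen: "A \<subseteq> polys V \<Longrightarrow> poly_ideal V (gen V A)"
  using ring.genideal_ideal[OF poly_ring_ring, of A V] by (simp add: ideal_iff_poly_ideal)

lemma gen_superset: "A \<subseteq> gen V A"
  unfolding genideal_def by fast

lemma gen_minimal: "poly_ideal V J \<Longrightarrow> A \<subseteq> J \<Longrightarrow> gen V A \<subseteq> J"
  unfolding genideal_def by (auto simp: ideal_iff_poly_ideal)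

lemma gen_mono: "A \<subseteq> B \<Longrightarrow> gen V A \<subseteq> gen V B"
  unfolding genideal_def by auto

lemma gen_Un_gen:
  assumes "A \<subseteq> polys V" "B \<subseteq> polys V"
  shows "gen V (gen V A \<union> B) = gen V (A \<union> B)"
proof
  show "gen V (gen V A \<union> B) \<subseteq> gen V (A \<union> B)"
    using assms gen_superset[of "A \<union> B" V] gen_mono[of A "A \<union> B" V]
    by (intro gen_minimal poly_ideal_gen) auto
  show "gen V (A \<union> B) \<subseteq> gen V (gen V A \<union> B)"
    using gen_superset[of A V] by (intro gen_mono) auto
qed

text \<open>The set on the right is itself an ideal containing \<open>f\<close> and
  \<open>J\<close>, so minimality gives the hard inclusion. The explicit form allows division by
  \<open>f\<close> modulo \<open>J\<close>.\<close>

lemma gen_insert: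
  fixes f :: "'k::field mpoly"
  assumes J: "poly_ideal V J" and f: "f \<in> polys V"
  shows "gen V (insert f J) = {p. \<exists>r\<in>polys V. \<exists>j\<in>J. p = f * r + j}" (is "_ = ?R")
proof
  have "poly_ideal V ?R"
    unfolding poly_ideal_def
  proof (intro conjI ballI subsetI)
    fix p assume "p \<in> ?R" then show "p \<in> polys V" using f poly_idealD[OF J] by auto
  next
    show "0 \<in> ?R" using poly_idealD(2)[OF J] by (auto intro!: bexI[of _ 0])
  next
    fix p q assume "p \<in> ?R" "q \<in> ?R"
    then obtain r j r' j' where *: "r \<in> polys V" "j \<in> J" "r' \<in> polys V" "j' \<in> J"
      "p = f * r + j" "q = f * r' + j'" by auto
    then have "p + q = f * (r + r') + (j + j')" by (simp add: algebra_simps)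
    with * show "p + q \<in> ?R" using poly_idealD(3)[OF J] polys_add by blast
  next
    fix s p :: "'k mpoly" assume s: "s \<in> polys V" and "p \<in> ?R"
    then obtain r j where *: "r \<in> polys V" "j \<in> J" "p = f * r + j" by auto
    then have "s * p = f * (s * r) + s * j" by (simp add: algebra_simps)
    with * s show "s * p \<in> ?R" using poly_idealD(4)[OF J] polys_mult by blast
  qed
  moreover have "f = f * 1 + 0" by simp
  then have "f \<in> ?R" using poly_idealD(2)[OF J] polys_one by blast
  moreover have "\<exists>r\<in>polys V. \<exists>j\<in>J. p = f * r + j" if "p \<in> J" for p
    using that by (intro bexI[of _ 0] bexI[of _ p]) auto
  then have "J \<subseteq> ?R" by blast
  ultimately show "gen V (insert f J) \<subseteq> ?R" by (intro gen_minimal) auto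
  have "insert f J \<subseteq> polys V" using f poly_idealD(1)[OF J] by auto
  note G = poly_ideal_gen[OF this]
  then show "?R \<subseteq> gen V (insert f J)"
    using gen_superset[of "insert f J" V] by (auto intro!: poly_idealD[OF G])
qed

lemma poly_ideal_zero: "poly_ideal V {0}"
  by (simp add: poly_ideal_def)


section \<open>Independent elements modulo an ideal\<close>

text \<open>The power product of the list \<open>gs\<close> with exponent vector \<open>as\<close>.
  It is meant for lists of equal length, since \<open>hd []\<close> is unspecified.\<close>

primrec mval :: "'k::field mpoly list \<Rightarrow> nat list \<Rightarrow> 'k mpoly" where
  "mval [] as = 1"
| "mval (g # gs) as = g ^ hd as * mval gs (tl as)"

text \<open>A polynomial in the \<open>gs\<close> is encoded by a finite set \<open>A\<close> of
  exponent vectors and a coefficient function \<open>c\<close>, so no second polynomial ring has to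
  be built. For the empty list the condition says that \<open>J\<close> contains no nonzero
  constant.\<close>

definition indep :: "'k::field mpoly set \<Rightarrow> 'k mpoly list \<Rightarrow> bool" where
  "indep J gs \<longleftrightarrow> (\<forall>A c. finite A \<longrightarrow> (\<forall>as\<in>A. length as = length gs) \<longrightarrow>
     (\<Sum>as\<in>A. Const (c as) * mval gs as) \<in> J \<longrightarrow> (\<forall>as\<in>A. c as = 0))"

definition regular_mod :: "point set \<Rightarrow> 'k::field mpoly set \<Rightarrow> 'k mpoly \<Rightarrow> bool" where
  "regular_mod V J f \<longleftrightarrow> (\<forall>g\<in>polys V. f * g \<in> J \<longrightarrow> g \<in> J)"

lemma indepD:
  "indep J gs \<Longrightarrow> finite A \<Longrightarrow> (\<And>as. as \<in> A \<Longrightarrow> length as = length gs) \<Longrightarrow>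
    (\<Sum>as\<in>A. Const (c as) * mval gs as) \<in> J \<Longrightarrow> as \<in> A \<Longrightarrow> c as = 0"
  unfolding indep_def by blast

lemma regular_modD: "regular_mod V J f \<Longrightarrow> f * g \<in> J \<Longrightarrow> g \<in> polys V \<Longrightarrow> g \<in> J"
  by (simp add: regular_mod_def)

lemma indep_antimono: "indep P gs \<Longrightarrow> J \<subseteq> P \<Longrightarrow> indep J gs"
  unfolding indep_def by blast

lemma polys_mval: "set gs \<subseteq> polys V \<Longrightarrow> mval gs as \<in> polys V"
  by (induction gs arbitrary: as) (auto simp: polys_power)

lemma regular_mod_power:
  assumes "regular_mod V J f" "f \<in> polys V" "g \<in> polys V" "f ^ n * g \<in> J"
  shows "g \<in> J"
  using assms(4)
proof (induction n)
  case (Suc n)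
  then have "f * (f ^ n * g) \<in> J" by (simp add: mult.assoc)
  moreover have "f ^ n * g \<in> polys V" by (intro polys_mult polys_power assms)
  ultimately have "f ^ n * g \<in> J" using assms(1) unfolding regular_mod_def by blast
  then show ?case by (rule Suc.IH)
qed simp

text \<open>Divide the relation by the largest possible power of \<open>f\<close> and collect the terms
  without \<open>f\<close>.\<close>

lemma relation_without_first:
  assumes J: "poly_ideal V J" and f: "f \<in> polys V" "regular_mod V J f"
    and gs: "set gs \<subseteq> polys V" and h: "h \<in> polys V"
    and A: "finite A" "\<forall>as\<in>A. length as = Suc (length gs)"
    and rel: "(\<Sum>as\<in>A. Const (c as) * mval (f # gs) as) * h \<in> J"
    and nz: "\<exists>as\<in>A. c as \<noteq> 0"
  obtains B c' s where "finite B" "\<forall>bs\<in>B. length bs = length gs" "\<exists>bs\<in>B. c' bs \<noteq> 0"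
    "s \<in> polys V" "(\<Sum>bs\<in>B. Const (c' bs) * mval gs bs) * h + f * (s * h) \<in> J"
proof -
  define A' where "A' = {as\<in>A. c as \<noteq> 0}"
  have A': "finite A'" "A' \<noteq> {}" using A nz by (auto simp: A'_def)
  define a where "a = Min (hd ` A')"
  have a_le: "a \<le> hd as" if "as \<in> A'" for as using A' that by (auto simp: a_def)
  \<comment> \<open>\<open>a\<close> is the least exponent of \<open>f\<close> in a term with
    nonzero coefficient. After division by \<open>f ^ a\<close> the terms in \<open>E\<close> are
    free of \<open>f\<close>, while those in \<open>F\<close> remain divisible by
    \<open>f\<close>.\<close>
  define E where "E = {as\<in>A'. hd as = a}"
  define F where "F = {as\<in>A'. hd as \<noteq> a}"
  have "a \<in> hd ` A'" unfolding a_def using A' by (intro Min_in) auto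
  then have "E \<noteq> {}" by (auto simp: E_def)
  define t where "t as = Const (c as) * mval gs (tl as)" for as
  have t: "t as \<in> polys V" for as using gs by (simp add: t_def polys_mval)
  define s where "s = (\<Sum>as\<in>F. f ^ (hd as - a - 1) * t as)"
  have s: "s \<in> polys V" unfolding s_def using t f by (intro polys_sum) (auto simp: polys_power)
  have "(\<Sum>as\<in>A. Const (c as) * mval (f # gs) as) = (\<Sum>as\<in>A'. Const (c as) * mval (f # gs) as)"
    unfolding A'_def using A by (intro sum.mono_neutral_right) auto
  also have "\<dots> = (\<Sum>as\<in>A'. f ^ a * (f ^ (hd as - a) * t as))"
  proof (rule sum.cong)
    fix as assume "as \<in> A'"
    from a_le[OF this] have "f ^ hd as = f ^ a * f ^ (hd as - a)" by (simp flip: power_add)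
    then show "Const (c as) * mval (f # gs) as = f ^ a * (f ^ (hd as - a) * t as)"
      by (simp add: t_def algebra_simps)
  qed simp
  also have "\<dots> = f ^ a * (\<Sum>as\<in>A'. f ^ (hd as - a) * t as)" by (simp add: sum_distrib_left)
  also have "(\<Sum>as\<in>A'. f ^ (hd as - a) * t as) =
      (\<Sum>as\<in>E. f ^ (hd as - a) * t as) + (\<Sum>as\<in>F. f ^ (hd as - a) * t as)"
    using A' by (subst sum.union_disjoint[symmetric]) (auto simp: E_def F_def intro!: sum.cong)
  also have "(\<Sum>as\<in>E. f ^ (hd as - a) * t as) = sum t E"
    by (auto simp: E_def intro!: sum.cong)
  also have "(\<Sum>as\<in>F. f ^ (hd as - a) * t as) = f * s"
    unfolding s_def sum_distrib_left
  proof (rule sum.cong)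
    fix as assume "as \<in> F"
    then have "hd as - a = Suc (hd as - a - 1)" using a_le[of as] by (auto simp: F_def)
    then have "f ^ (hd as - a) = f * f ^ (hd as - a - 1)" by (metis power_Suc)
    then show "f ^ (hd as - a) * t as = f * (f ^ (hd as - a - 1) * t as)" by (simp add: mult.assoc)
  qed simp
  finally have "f ^ a * ((sum t E + f * s) * h) \<in> J" using rel by (simp add: mult.assoc)
  moreover have "(sum t E + f * s) * h \<in> polys V"
    by (intro polys_mult polys_add polys_sum t s f h)
  ultimately have *: "(sum t E + f * s) * h \<in> J"
    using regular_mod_power[OF f(2,1)] by blast
  have Cons: "a # tl as = as" if "as \<in> E" for as
    using that A(2) by (cases as) (auto simp: E_def A'_def)
  \<comment> \<open>All vectors in \<open>E\<close> start with \<open>a\<close>, so dropping the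
    first entry merges no terms and the new relation keeps a nonzero coefficient.\<close>
  have "inj_on tl E"
  proof (rule inj_onI)
    fix x y assume "x \<in> E" "y \<in> E" "tl x = tl y"
    then show "x = y" using Cons[of x] Cons[of y] by argo
  qed
  then have "(\<Sum>bs\<in>tl ` E. Const (c (a # bs)) * mval gs bs) = sum t E"
    by (subst sum.reindex) (simp_all add: t_def Cons)
  with * have "(\<Sum>bs\<in>tl ` E. Const (c (a # bs)) * mval gs bs) * h + f * (s * h) \<in> J"
    by (simp add: algebra_simps)
  moreover obtain es where "es \<in> E" using \<open>E \<noteq> {}\<close> by blast
  then have "c (a # tl es) \<noteq> 0" unfolding Cons[OF \<open>es \<in> E\<close>] by (simp add: E_def A'_def)
  then have "\<exists>bs\<in>tl ` E. c (a # bs) \<noteq> 0" using \<open>es \<in> E\<close> by blast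
  moreover have "\<forall>bs\<in>tl ` E. length bs = length gs" using A(2) by (simp add: E_def A'_def)
  moreover have "finite (tl ` E)" using A' by (simp add: E_def)
  ultimately show ?thesis using s by (intro that[of "tl ` E" "\<lambda>bs. c (a # bs)" s])
qed

text \<open>A relation modulo \<open>J\<close> is reduced to a nontrivial expression in
  \<open>gs\<close> plus a multiple of \<open>f\<close> lying in \<open>J\<close>. As
  \<open>f\<close> and \<open>J\<close> lie in \<open>P\<close>, the expression in \<open>gs\<close>
  lies in \<open>P\<close>, against independence modulo \<open>P\<close>. Regular sequences and
  prime chains both iterate this step.\<close>

lemma indep_Cons:
  assumes J: "poly_ideal V J" and P: "poly_ideal V P" "J \<subseteq> P"
    and f: "f \<in> P" "regular_mod V J f" and gs: "set gs \<subseteq> polys V" "indep P gs"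
  shows "indep J (f # gs)"
  unfolding indep_def
proof (intro allI impI, rule ccontr)
  fix A :: "nat list set" and c :: "nat list \<Rightarrow> 'a"
  assume A: "finite A" "\<forall>as\<in>A. length as = length (f # gs)"
    and rel: "(\<Sum>as\<in>A. Const (c as) * mval (f # gs) as) \<in> J" and nz: "\<not> (\<forall>as\<in>A. c as = 0)"
  have rel': "(\<Sum>as\<in>A. Const (c as) * mval (f # gs) as) * 1 \<in> J"
    and A': "\<forall>as\<in>A. length as = Suc (length gs)" and nz': "\<exists>as\<in>A. c as \<noteq> 0"
    using A rel nz by auto
  obtain B c' s where *: "finite B" "\<forall>bs\<in>B. length bs = length gs" "\<exists>bs\<in>B. c' bs \<noteq> 0"
    "s \<in> polys V" "(\<Sum>bs\<in>B. Const (c' bs) * mval gs bs) * 1 + f * (s * 1) \<in> J"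
    using relation_without_first[OF J poly_idealD(1)[OF P(1) f(1)] f(2) gs(1) polys_one A(1) A' rel' nz'] .
  then have "(\<Sum>bs\<in>B. Const (c' bs) * mval gs bs) + f * s \<in> P" using P by auto
  then have "(\<Sum>bs\<in>B. Const (c' bs) * mval gs bs) \<in> P"
    by (rule poly_ideal_add_cancel[OF P(1)]) (rule poly_idealD(5)[OF P(1) *(4) f(1)])
  then have "\<forall>bs\<in>B. c' bs = 0"
    using gs(2)[unfolded indep_def, rule_format, of B c'] *(1,2) by blast
  with *(3) show False by blast
qed

section \<open>Independent elements obtained from regular sequences and from chains of
  primes\<close>

primrec regseq :: "point set \<Rightarrow> 'k::field mpoly set \<Rightarrow> 'k mpoly list \<Rightarrow> bool" where
  "regseq V J [] \<longleftrightarrow> True"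
| "regseq V J (f # fs) \<longleftrightarrow> regular_mod V J f \<and> regseq V (gen V (insert f J)) fs"

lemma gen_ideal: "poly_ideal V J \<Longrightarrow> gen V J = J"
  using gen_superset[of J V] gen_minimal[of V J J] by auto

lemma gen_insert_Un:
  assumes "poly_ideal V J" "f \<in> polys V" "X \<subseteq> polys V"
  shows "gen V (gen V (insert f J) \<union> X) = gen V (J \<union> insert f X)"
  using gen_Un_gen[of "insert f J" V X] assms poly_idealD(1) by fastforce

lemma regseqI:
  assumes "poly_ideal V J" "set fs \<subseteq> polys V"
    "\<And>i. i < length fs \<Longrightarrow> regular_mod V (gen V (J \<union> set (take i fs))) (fs ! i)"
  shows "regseq V J fs"
  using assms
proof (induction fs arbitrary: J)
  case (Cons f fs)
  have fJ: "insert f J \<subseteq> polys V" using Cons.prems poly_idealD(1) by auto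
  have "regseq V (gen V (insert f J)) fs"
  proof (rule Cons.IH)
    show "poly_ideal V (gen V (insert f J))" by (rule poly_ideal_gen[OF fJ])
    fix i assume "i < length fs"
    moreover have "set (take i fs) \<subseteq> polys V" using Cons.prems(2) set_take_subset[of i fs] by auto
    ultimately show "regular_mod V (gen V (gen V (insert f J) \<union> set (take i fs))) (fs ! i)"
      using Cons.prems(3)[of "Suc i"] Cons.prems(1,2) by (simp add: gen_insert_Un)
  qed (use Cons.prems in auto)
  then show ?case using Cons.prems(3)[of 0] Cons.prems(1) by (simp add: gen_ideal)
qed simp

text \<open>Iterates \<open>indep_Cons\<close> along the ideals generated by \<open>J\<close> and
  the initial segments of \<open>fs\<close>: starting from \<open>ts\<close>, the elements of
  \<open>fs\<close> are prepended from the last to the first.\<close>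

lemma indep_regseq:
  assumes "poly_ideal V J" "set fs \<subseteq> polys V" "set ts \<subseteq> polys V" "regseq V J fs"
    "indep (gen V (J \<union> set fs)) ts"
  shows "indep J (fs @ ts)"
  using assms
proof (induction fs arbitrary: J)
  case Nil
  then show ?case by (simp add: gen_ideal)
next
  case (Cons f fs)
  have fJ: "insert f J \<subseteq> polys V" using Cons.prems poly_idealD(1) by auto
  note I = poly_ideal_gen[OF fJ]
  have "indep (gen V (insert f J)) (fs @ ts)"
    by (rule Cons.IH) (use Cons.prems I gen_insert_Un[of V J f "set fs"] in auto)
  then show ?case
    using indep_Cons[OF Cons.prems(1) I _ _ _ _ \<open>indep _ (fs @ ts)\<close>, of f]
      Cons.prems gen_superset[of "insert f J" V] by auto
qed

lemma primeidealD:
  assumes "primeideal Q (poly_ring V)"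
  shows "poly_ideal V Q" "1 \<notin> Q"
    "p \<in> polys V \<Longrightarrow> q \<in> polys V \<Longrightarrow> p * q \<in> Q \<Longrightarrow> p \<in> Q \<or> q \<in> Q"
    "f \<in> polys V \<Longrightarrow> f \<notin> Q \<Longrightarrow> regular_mod V Q f"
  using assms by (auto simp: primeideal_iff regular_mod_def)

text \<open>Any element of \<open>Q (Suc n)\<close> outside \<open>Q n\<close> is regular modulo the
  prime \<open>Q n\<close>, so each step down the chain yields one more independent element. This
  replaces dimension theory as the upper bound for chain lengths.\<close>

lemma indep_prime_chain:
  assumes "prime_chain (poly_ring V) n Q" "set ts \<subseteq> polys V" "indep (Q n) ts"
  shows "\<exists>gs. length gs = n + length ts \<and> set gs \<subseteq> polys V \<and> indep (Q 0) gs"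
  using assms
proof (induction n arbitrary: ts)
  case (Suc n)
  have Q: "primeideal (Q n) (poly_ring V)" "primeideal (Q (Suc n)) (poly_ring V)" "Q n \<subset> Q (Suc n)"
    using Suc.prems(1) by (auto simp: prime_chain_def)
  then obtain f where f: "f \<in> Q (Suc n)" "f \<notin> Q n" by auto
  then have fV: "f \<in> polys V" using primeidealD(1)[OF Q(2)] poly_idealD(1) by blast
  have "indep (Q n) (f # ts)"
    by (rule indep_Cons[OF primeidealD(1)[OF Q(1)] primeidealD(1)[OF Q(2)]])
       (use Q f fV Suc.prems primeidealD(4)[OF Q(1)] in auto)
  moreover have "prime_chain (poly_ring V) n Q" using Suc.prems(1) by (simp add: prime_chain_def)
  ultimately show ?case using Suc.IH[of "f # ts"] Suc.prems fV by auto
qed auto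


section \<open>At most \<open>card V\<close> independent elements\<close>

interpretation mpoly: vector_space "\<lambda>c p. Const c * p"
  by unfold_locales (auto simp: Const_add Const_mult algebra_simps)

text \<open>The bound is on each exponent separately rather than on the total degree, so that the
  number of monomials is bounded by a plain power.\<close>

definition mons_upto :: "point set \<Rightarrow> nat \<Rightarrow> (point \<Rightarrow>\<^sub>0 nat) set" where
  "mons_upto V k = {m. Poly_Mapping.keys m \<subseteq> V \<and> (\<forall>v. Poly_Mapping.lookup m v \<le> k)}"

lemma mons_upto_card:
  assumes "finite V"
  shows "finite (mons_upto V k)" "card (mons_upto V k) \<le> Suc k ^ card V"
proof -
  let ?F = "\<lambda>m. restrict (Poly_Mapping.lookup m) V"
  have "inj_on ?F (mons_upto V k)"
  proof (rule inj_onI, rule poly_mapping_eqI)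
    fix m n v assume *: "m \<in> mons_upto V k" "n \<in> mons_upto V k" "?F m = ?F n"
    show "Poly_Mapping.lookup m v = Poly_Mapping.lookup n v"
    proof (cases "v \<in> V")
      case True
      then show ?thesis using *(3) by (metis restrict_apply')
    next
      case False
      then have "v \<notin> Poly_Mapping.keys m" "v \<notin> Poly_Mapping.keys n"
        using * by (auto simp: mons_upto_def)
      then show ?thesis by (simp add: in_keys_iff)
    qed
  qed
  moreover have "?F ` mons_upto V k \<subseteq> V \<rightarrow>\<^sub>E {..k}" by (auto simp: mons_upto_def)
  moreover have "finite (V \<rightarrow>\<^sub>E {..k})" "card (V \<rightarrow>\<^sub>E {..k}) = Suc k ^ card V"
    using assms by (auto simp: card_PiE finite_PiE)
  ultimately show "finite (mons_upto V k)" "card (mons_upto V k) \<le> Suc k ^ card V"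
    by (metis inj_on_finite, metis card_inj_on_le)
qed

lemma mons_upto_mult:
  assumes "Poly_Mapping.keys p \<subseteq> mons_upto V k" "Poly_Mapping.keys q \<subseteq> mons_upto V l"
  shows "Poly_Mapping.keys (p * q) \<subseteq> mons_upto V (k + l)"
proof
  fix m assume "m \<in> Poly_Mapping.keys (p * q)"
  then obtain a b where "m = a + b" "a \<in> Poly_Mapping.keys p" "b \<in> Poly_Mapping.keys q"
    using Poly_Mapping.keys_mult[of p q] by auto
  with assms have "a \<in> mons_upto V k" "b \<in> mons_upto V l" "m = a + b" by auto
  then show "m \<in> mons_upto V (k + l)"
    by (auto simp: mons_upto_def keys_add_nat lookup_add intro: add_mono)
qed

lemma mons_upto_mono: "k \<le> l \<Longrightarrow> mons_upto V k \<subseteq> mons_upto V l"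
  by (auto simp: mons_upto_def intro: le_trans)

lemma mons_upto_one: "Poly_Mapping.keys (1 :: 'k::field mpoly) \<subseteq> mons_upto V 0"
  by (auto simp: mons_upto_def)

lemma mons_upto_power:
  "Poly_Mapping.keys p \<subseteq> mons_upto V k \<Longrightarrow> Poly_Mapping.keys (p ^ n) \<subseteq> mons_upto V (n * k)"
proof (induction n)
  case 0 then show ?case using mons_upto_one by auto
next
  case (Suc n) then show ?case using mons_upto_mult[of p V k "p ^ n" "n * k"] by simp
qed

lemma mons_upto_mval:
  assumes "\<forall>g\<in>set gs. Poly_Mapping.keys g \<subseteq> mons_upto V d" "length as = length gs" "\<forall>a\<in>set as. a \<le> N"
  shows "Poly_Mapping.keys (mval gs as) \<subseteq> mons_upto V (length gs * (N * d))"
  using assms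
proof (induction gs arbitrary: as)
  case Nil then show ?case using mons_upto_one by auto
next
  case (Cons g gs)
  then obtain a bs where as: "as = a # bs" by (cases as) auto
  have "Poly_Mapping.keys (g ^ a) \<subseteq> mons_upto V (a * d)" using Cons.prems by (intro mons_upto_power) auto
  also have "\<dots> \<subseteq> mons_upto V (N * d)" using Cons.prems as by (intro mons_upto_mono) auto
  finally show ?case using Cons.IH[of bs] Cons.prems as mons_upto_mult[of "g ^ a" V "N * d" "mval gs bs"]
    by auto
qed

lemma exists_mons_upto:
  assumes "set gs \<subseteq> polys V"
  shows "\<exists>d. \<forall>g\<in>set gs. Poly_Mapping.keys g \<subseteq> mons_upto V d"
proof -
  define M where "M = (\<Union>g\<in>set gs. Poly_Mapping.keys g)"
  define E where "E = (\<Union>m\<in>M. Poly_Mapping.lookup m ` Poly_Mapping.keys m)"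
  have "finite E" by (auto simp: E_def M_def)
  have "Poly_Mapping.lookup m v \<in> insert 0 E" if "m \<in> M" for m v
  proof (cases "v \<in> Poly_Mapping.keys m")
    case True
    then show ?thesis using that unfolding E_def by blast
  qed (simp add: in_keys_iff)
  with \<open>finite E\<close> have "Poly_Mapping.lookup m v \<le> Max (insert 0 E)" if "m \<in> M" for m v
    using that by (metis Max_ge finite_insert)
  then have "\<forall>g\<in>set gs. Poly_Mapping.keys g \<subseteq> mons_upto V (Max (insert 0 E))"
    using assms by (auto simp: mons_upto_def M_def polys_iff subset_iff)
  then show ?thesis by blast
qed

lemma poly_mapping_sum_singles:
  "(\<Sum>m\<in>Poly_Mapping.keys p. Poly_Mapping.single m (Poly_Mapping.lookup p m)) = p"
proof (rule poly_mapping_eqI)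
  fix k
  show "Poly_Mapping.lookup (\<Sum>m\<in>Poly_Mapping.keys p. Poly_Mapping.single m (Poly_Mapping.lookup p m)) k = Poly_Mapping.lookup p k"
    by (cases "k \<in> Poly_Mapping.keys p")
       (auto simp: lookup_sum lookup_single when_def sum.delta in_keys_iff)
qed

lemma keys_subset_span:
  assumes "Poly_Mapping.keys p \<subseteq> M"
  shows "p \<in> mpoly.span ((\<lambda>m. Poly_Mapping.single m 1) ` M)"
proof -
  have "(\<Sum>m\<in>Poly_Mapping.keys p. Const (Poly_Mapping.lookup p m) * Poly_Mapping.single m 1) \<in>
      mpoly.span ((\<lambda>m. Poly_Mapping.single m 1) ` M)"
    using assms by (intro mpoly.span_sum mpoly.span_scale mpoly.span_base) auto
  also have "(\<Sum>m\<in>Poly_Mapping.keys p. Const (Poly_Mapping.lookup p m) * Poly_Mapping.single m 1) = p"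
    by (simp add: Const_def mult_single poly_mapping_sum_singles)
  finally show ?thesis .
qed

text \<open>The power products of \<open>gs\<close> with exponents at most \<open>N\<close> are
  \<open>Suc N ^ length gs\<close> linearly independent polynomials. They lie in the span of
  monomials whose exponents grow only linearly in \<open>N\<close>, and there are at most a constant
  times \<open>Suc N ^ card V\<close> of these.\<close>

lemma indep_length:
  fixes gs :: "'k::field mpoly list"
  assumes gs: "indep {0} gs" "set gs \<subseteq> polys V" and V: "finite V"
  shows "length gs \<le> card V"
proof (rule ccontr)
  assume "\<not> ?thesis"
  then have len: "Suc (card V) \<le> length gs" by simp
  obtain d where d: "\<forall>g\<in>set gs. Poly_Mapping.keys g \<subseteq> mons_upto V d"
    using exists_mons_upto[OF gs(2)] by blast
  \<comment> \<open>The number of available monomials is at most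
    \<open>(e * Suc N) ^ card V\<close>. With \<open>N = e ^ card V\<close> this is
    \<open>N * Suc N ^ card V\<close>, just below \<open>Suc N ^ Suc (card V)\<close>.\<close>
  define e where "e = Suc (length gs * d)"
  define N where "N = e ^ card V"
  define A where "A = {as. set as \<subseteq> {..N} \<and> length as = length gs}"
  have A: "finite A" "card A = Suc N ^ length gs"
    by (auto simp: A_def card_lists_length_eq finite_lists_length_eq)
  \<comment> \<open>If two power products coincided, their difference would be a nontrivial relation
    with coefficients \<open>1\<close> and \<open>- 1\<close>.\<close>
  have inj: "inj_on (mval gs) A"
  proof (rule inj_onI, rule ccontr)
    fix as bs assume *: "as \<in> A" "bs \<in> A" "mval gs as = mval gs bs" "as \<noteq> bs"
    define c :: "nat list \<Rightarrow> 'k" where "c x = (if x = as then 1 else - 1)" for x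
    have "(\<Sum>x\<in>{as, bs}. Const (c x) * mval gs x) = mval gs as + Const (- 1) * mval gs as"
      using * by (auto simp: c_def)
    also have "\<dots> = Const (1 + (-1)) * mval gs as" by (simp only: Const_add) (simp add: algebra_simps)
    finally have "(\<Sum>x\<in>{as, bs}. Const (c x) * mval gs x) \<in> {0}" by simp
    then have "c as = 0"
      by (rule indepD[OF gs(1), rotated 2]) (use *(1,2) in \<open>auto simp: A_def\<close>)
    then show False by (simp add: c_def)
  qed
  have "mpoly.independent (mval gs ` A)"
  proof (rule mpoly.independent_if_scalars_zero)
    fix f x assume 0: "(\<Sum>x\<in>mval gs ` A. Const (f x) * x) = 0" and "x \<in> mval gs ` A"
    then obtain as where as: "as \<in> A" "x = mval gs as" by auto
    have "(\<Sum>as\<in>A. Const (f (mval gs as)) * mval gs as) = 0"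
      using 0 by (simp add: sum.reindex[OF inj])
    then have "f (mval gs as) = 0"
      by (intro indepD[OF gs(1) A(1), of "\<lambda>as. f (mval gs as)"])
         (use as(1) in \<open>simp_all add: A_def\<close>)
    then show "f x = 0" using as by simp
  qed (use A in auto)
  moreover have "mval gs ` A \<subseteq> mpoly.span ((\<lambda>m. Poly_Mapping.single m 1) `
      mons_upto V (length gs * (N * d)))"
    using mons_upto_mval[OF d, of _ N] by (auto simp: A_def intro!: keys_subset_span)
  ultimately have "card (mval gs ` A) \<le>
      card ((\<lambda>m. Poly_Mapping.single m (1::'k)) ` mons_upto V (length gs * (N * d)))"
    using mons_upto_card(1)[OF V] by (intro mpoly.independent_span_bound[THEN conjunct2]) auto
  also have "\<dots> \<le> card (mons_upto V (length gs * (N * d)))"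
    using mons_upto_card(1)[OF V] by (rule card_image_le)
  also have "\<dots> \<le> Suc (length gs * (N * d)) ^ card V" by (rule mons_upto_card(2)[OF V])
  also have "\<dots> \<le> (e * Suc N) ^ card V" by (intro power_mono) (auto simp: e_def algebra_simps)
  also have "\<dots> = N * Suc N ^ card V" by (simp only: power_mult_distrib N_def)
  also have "\<dots> < Suc N ^ Suc (card V)" by simp
  also have "\<dots> \<le> Suc N ^ length gs" using len by (intro power_increasing) auto
  finally show False using A card_image[OF inj] by simp
qed


section \<open>Homogeneous regular sequences on graded quotients\<close>

text \<open>The sum of the homogeneous components of degree below \<open>n\<close>. The condition
  \<open>trunc n h = h\<close> then bounds the degree of \<open>h\<close>, which suits induction on
  \<open>n\<close>.\<close>

definition trunc :: "nat \<Rightarrow> 'k::field mpoly \<Rightarrow> 'k mpoly" where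
  "trunc n p = Poly_Mapping.mapp (\<lambda>m c. c when mon_degree m < n) p"

lemma lookup_trunc: "Poly_Mapping.lookup (trunc n p) m = (Poly_Mapping.lookup p m when mon_degree m < n)"
  by (auto simp: trunc_def lookup_mapp when_def in_keys_iff)

lemma keys_trunc: "Poly_Mapping.keys (trunc n p) = {m \<in> Poly_Mapping.keys p. mon_degree m < n}"
  by (auto simp: in_keys_iff lookup_trunc)

lemma trunc_add: "trunc n (p + q) = trunc n p + trunc n q"
  by (rule poly_mapping_eqI) (simp add: lookup_trunc lookup_add when_add_distrib)

lemma trunc_zero [simp]: "trunc n 0 = 0" and trunc_0 [simp]: "trunc 0 p = 0"
  by (auto intro!: poly_mapping_eqI simp: lookup_trunc)

lemma polys_trunc: "p \<in> polys V \<Longrightarrow> trunc n p \<in> polys V"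
  by (auto simp: polys_iff keys_trunc)

lemma trunc_id: "(\<And>m. m \<in> Poly_Mapping.keys p \<Longrightarrow> mon_degree m < n) \<Longrightarrow> trunc n p = p"
  by (rule poly_mapping_eqI) (auto simp: lookup_trunc when_def in_keys_iff)

lemma trunc_eq_0: "(\<And>m. m \<in> Poly_Mapping.keys p \<Longrightarrow> n \<le> mon_degree m) \<Longrightarrow> trunc n p = 0"
  by (rule poly_mapping_eqI) (force simp: lookup_trunc when_def in_keys_iff)

lemma mon_degree_superset:
  "finite X \<Longrightarrow> Poly_Mapping.keys m \<subseteq> X \<Longrightarrow> mon_degree m = (\<Sum>v\<in>X. Poly_Mapping.lookup m v)"
  unfolding mon_degree_def by (rule sum.mono_neutral_left) (auto simp: in_keys_iff)

lemma mon_degree_add: "mon_degree (m + n) = mon_degree m + mon_degree n"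
  by (subst (1 2 3) mon_degree_superset[of "Poly_Mapping.keys m \<union> Poly_Mapping.keys n"])
     (auto simp: keys_add_nat lookup_add sum.distrib)

text \<open>Multiplication by the homogeneous \<open>f\<close> shifts degrees by \<open>d\<close>.
  The truncated subtraction is also right for \<open>n < d\<close>, where both sides are
  zero.\<close>

lemma trunc_mult:
  assumes f: "\<And>m. m \<in> Poly_Mapping.keys f \<Longrightarrow> mon_degree m = d"
  shows "trunc n (f * g) = f * trunc (n - d) g"
proof -
  let ?h = "trunc (n - d) g"
  have split: "f * g = f * ?h + f * (g - ?h)" by (simp add: algebra_simps)
  have deg: "\<exists>b\<in>Poly_Mapping.keys q. mon_degree m = d + mon_degree b"
    if "m \<in> Poly_Mapping.keys (f * q)" for m and q :: "'a mpoly"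
    using that Poly_Mapping.keys_mult[of f q] f by (fastforce simp: mon_degree_add)
  have "trunc n (f * ?h) = f * ?h"
    by (rule trunc_id) (use deg in \<open>fastforce simp: keys_trunc\<close>)
  moreover have "n - d \<le> mon_degree b" if "b \<in> Poly_Mapping.keys (g - ?h)" for b
    using that by (auto simp: in_keys_iff lookup_minus lookup_trunc when_def split: if_splits)
  then have "trunc n (f * (g - ?h)) = 0"
    by (intro trunc_eq_0) (use deg in fastforce)
  ultimately show ?thesis by (subst split) (simp add: trunc_add)
qed

text \<open>Homogeneity of an ideal: the homogeneous components are differences of consecutive
  truncations.\<close>

definition graded :: "'k::field mpoly set \<Rightarrow> bool" where
  "graded J \<longleftrightarrow> (\<forall>p\<in>J. \<forall>n. trunc n p \<in> J)"

lemma graded_gen_insert: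
  assumes "poly_ideal V J" "graded J" "f \<in> polys V" "\<And>m. m \<in> Poly_Mapping.keys f \<Longrightarrow> mon_degree m = d"
  shows "graded (gen V (insert f J))"
  unfolding graded_def
proof (intro ballI allI)
  fix p n assume "p \<in> gen V (insert f J)"
  then obtain r j where "r \<in> polys V" "j \<in> J" "p = f * r + j"
    using gen_insert[OF assms(1,3)] by auto
  then have "trunc n p = f * trunc (n - d) r + trunc n j" "trunc n j \<in> J"
    using assms(2) trunc_mult[of f d n r] assms(4) by (auto simp: trunc_add graded_def)
  with \<open>r \<in> polys V\<close> show "trunc n p \<in> gen V (insert f J)"
    using gen_insert[OF assms(1,3)] polys_trunc by blast
qed

lemma graded_gen_finite:
  assumes "finite A" "A \<subseteq> polys V" "\<And>f. f \<in> A \<Longrightarrow> \<exists>d. \<forall>m\<in>Poly_Mapping.keys f. mon_degree m = d"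
  shows "graded (gen V A)"
  using assms
proof (induction rule: finite_induct)
  case empty
  have "gen V {} \<subseteq> {0::'a mpoly}" by (intro gen_minimal poly_ideal_zero) auto
  then show ?case by (auto simp: graded_def)
next
  case (insert f A)
  have A: "A \<subseteq> polys V" and f: "f \<in> polys V" using insert.prems by auto
  obtain d where "\<forall>m\<in>Poly_Mapping.keys f. mon_degree m = d" using insert.prems(2)[of f] by auto
  then have "graded (gen V (insert f (gen V A)))"
    using insert A f by (intro graded_gen_insert poly_ideal_gen) auto
  then show ?case using gen_Un_gen[OF A, of "{f}"] f by simp
qed

text \<open>A relation would make \<open>h\<close> divisible by the first element modulo
  the ideal, and the quotient, of smaller degree, satisfies the same relation.\<close>

lemma homogeneous_regseq_relation:
  assumes "poly_ideal V J" "graded J" "set fs \<subseteq> polys V" "regseq V J fs"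
    "\<And>f. f \<in> set fs \<Longrightarrow> \<exists>d>0. \<forall>m\<in>Poly_Mapping.keys f. mon_degree m = d"
    "finite A" "\<forall>as\<in>A. length as = length fs" "\<exists>as\<in>A. c as \<noteq> 0"
    "h \<in> polys V" "(\<Sum>as\<in>A. Const (c as) * mval fs as) * h \<in> J"
  shows "h \<in> J"
  using assms
proof (induction fs arbitrary: J A c h)
  case Nil
  \<comment> \<open>Only the empty exponent vector is possible, so the relation is a nonzero
    constant times \<open>h\<close>, and the constant is invertible.\<close>
  from Nil.prems(7,8) have A: "A = {[]}" by auto
  have c: "Const (c []) * h \<in> J" "c [] \<noteq> 0" using Nil.prems(8,10) unfolding A by auto
  have "Const (inverse (c [])) * (Const (c []) * h) \<in> J"
    by (rule poly_idealD(4)[OF Nil.prems(1) polys_Const c(1)])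
  also have "Const (inverse (c [])) * (Const (c []) * h) = Const (inverse (c []) * c []) * h"
    by (simp only: Const_mult mult.assoc)
  finally show ?case using c(2) by simp
next
  case (Cons f fs)
  have f: "f \<in> polys V" "set fs \<subseteq> polys V" "regular_mod V J f" "regseq V (gen V (insert f J)) fs"
    using Cons.prems(3,4) by auto
  obtain d where d: "d > 0" "\<forall>m\<in>Poly_Mapping.keys f. mon_degree m = d"
    using Cons.prems(5)[of f] by auto
  have fJ: "insert f J \<subseteq> polys V" using f(1) poly_idealD(1)[OF Cons.prems(1)] by auto
  note I = poly_ideal_gen[OF fJ]
  have gr: "graded (gen V (insert f J))"
    by (rule graded_gen_insert[OF Cons.prems(1,2) f(1), of d]) (use d in blast)
  have fs: "\<exists>d>0. \<forall>m\<in>Poly_Mapping.keys g. mon_degree m = d" if "g \<in> set fs" for g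
    using Cons.prems(5)[of g] that by simp
  let ?p = "\<Sum>as\<in>A. Const (c as) * mval (f # fs) as"
  have p: "?p \<in> polys V" by (intro polys_sum polys_mult polys_mval polys_Const) (use f(1,2) in simp)
  \<comment> \<open>Inner induction on a degree bound for \<open>h\<close>, with the relation
    \<open>?p\<close> fixed. The outer induction on the list is applied to the larger ideal
    generated by \<open>f\<close> and \<open>J\<close>.\<close>
  have descent: "trunc n h \<in> J" if "h \<in> polys V" "?p * h \<in> J" "trunc n h = h" for n h
    using that
  proof (induction n arbitrary: h)
    case 0
    then show ?case using poly_idealD(2)[OF Cons.prems(1)] by simp
  next
    case (Suc n)
    have A': "\<forall>as\<in>A. length as = Suc (length fs)" using Cons.prems(7) by simp
    obtain B c' s where B: "finite B" "\<forall>bs\<in>B. length bs = length fs" "\<exists>bs\<in>B. c' bs \<noteq> 0"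
      "s \<in> polys V" "(\<Sum>bs\<in>B. Const (c' bs) * mval fs bs) * h + f * (s * h) \<in> J"
      using relation_without_first[OF Cons.prems(1) f(1,3,2) Suc.prems(1) Cons.prems(6) A'
          Suc.prems(2) Cons.prems(8)] .
    have "f \<in> gen V (insert f J)" "J \<subseteq> gen V (insert f J)"
      using gen_superset[of "insert f J" V] by auto
    then have "(\<Sum>bs\<in>B. Const (c' bs) * mval fs bs) * h \<in> gen V (insert f J)"
      using poly_ideal_add_cancel[OF I subsetD[OF _ B(5)] poly_idealD(5)[OF I]]
        polys_mult[OF B(4) Suc.prems(1)] by metis
    then have "h \<in> gen V (insert f J)"
      by (intro Cons.IH[OF I gr f(2,4) _ B(1-3) Suc.prems(1)] fs)
    then obtain r j where rj: "r \<in> polys V" "j \<in> J" "h = f * r + j"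
      using gen_insert[OF Cons.prems(1) f(1)] by auto
    \<comment> \<open>Truncating \<open>h = f * r + j\<close> below degree \<open>Suc n\<close>
      leaves \<open>h\<close> unchanged and keeps the second summand in \<open>J\<close>. Since
      \<open>d > 0\<close>, the quotient \<open>h'\<close> has degree below
      \<open>n\<close>.\<close>
    define h' where "h' = trunc (Suc n - d) r"
    define j' where "j' = trunc (Suc n) j"
    have h: "h = f * h' + j'"
      using trunc_mult[of f d "Suc n" r] d(2) Suc.prems(3)
      unfolding rj(3) trunc_add h'_def j'_def by metis
    have j': "j' \<in> J" using rj(2) Cons.prems(2) by (simp add: j'_def graded_def)
    have h': "h' \<in> polys V" "trunc n h' = h'"
      using rj(1) d(1) by (auto simp: h'_def polys_trunc keys_trunc intro!: trunc_id)
    have "?p * h - ?p * j' \<in> J"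
      by (rule poly_ideal_diff[OF Cons.prems(1) Suc.prems(2) poly_idealD(4)[OF Cons.prems(1) p j']])
    also have "?p * h - ?p * j' = f * (?p * h')" by (simp only: h) (simp add: algebra_simps)
    finally have "?p * h' \<in> J" by (rule regular_modD[OF f(3)]) (intro polys_mult p h')
    then have "h' \<in> J" using Suc.IH[of h'] h' by simp
    have "h \<in> J" unfolding h
      by (intro poly_idealD(3)[OF Cons.prems(1)] poly_idealD(4)[OF Cons.prems(1)] f j' \<open>h' \<in> J\<close>)
    with Suc.prems(3) show ?case by simp
  qed
  \<comment> \<open>A strict bound for all degrees in \<open>h\<close>; inserting \<open>0\<close>
    covers \<open>h = 0\<close>.\<close>
  define n where "n = Suc (Max (insert 0 (mon_degree ` Poly_Mapping.keys h)))"
  have "trunc n h = h" by (rule trunc_id) (auto simp: n_def less_Suc_eq_le)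
  then show ?case using descent[OF Cons.prems(9,10), of n] by simp
qed


section \<open>Evaluation of polynomials\<close>

definition mon_ev :: "(point \<Rightarrow> 'b::comm_ring_1) \<Rightarrow> (point \<Rightarrow>\<^sub>0 nat) \<Rightarrow> 'b" where
  "mon_ev w m = (\<Prod>v\<in>Poly_Mapping.keys m. w v ^ Poly_Mapping.lookup m v)"

text \<open>The map \<open>h\<close> on coefficients is a parameter because values are taken both in
  the polynomial ring and in its field of fractions.\<close>

definition ev :: "('k::field \<Rightarrow> 'b::comm_ring_1) \<Rightarrow> (point \<Rightarrow> 'b) \<Rightarrow> 'k mpoly \<Rightarrow> 'b" where
  "ev h w p = (\<Sum>m\<in>Poly_Mapping.keys p. h (Poly_Mapping.lookup p m) * mon_ev w m)"

lemma mon_ev_superset: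
  "finite X \<Longrightarrow> Poly_Mapping.keys m \<subseteq> X \<Longrightarrow> mon_ev w m = (\<Prod>v\<in>X. w v ^ Poly_Mapping.lookup m v)"
  unfolding mon_ev_def by (rule prod.mono_neutral_left) (auto simp: in_keys_iff)

lemma mon_ev_add: "mon_ev w (m + n) = mon_ev w m * mon_ev w n"
  by (subst (1 2 3) mon_ev_superset[of "Poly_Mapping.keys m \<union> Poly_Mapping.keys n"])
     (auto simp: keys_add_nat lookup_add power_add prod.distrib)

lemma mon_ev_zero [simp]: "mon_ev w 0 = 1"
  by (simp add: mon_ev_def)

locale coeff_hom =
  fixes h :: "'k::field \<Rightarrow> 'b::comm_ring_1"
  assumes h0 [simp]: "h 0 = 0" and h1 [simp]: "h 1 = 1"
    and h_add: "h (a + b) = h a + h b" and h_mult: "h (a * b) = h a * h b"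
begin

lemma ev_superset:
  "finite X \<Longrightarrow> Poly_Mapping.keys p \<subseteq> X \<Longrightarrow> ev h w p = (\<Sum>m\<in>X. h (Poly_Mapping.lookup p m) * mon_ev w m)"
  unfolding ev_def by (rule sum.mono_neutral_left) (auto simp: in_keys_iff)

lemma ev_zero [simp]: "ev h w 0 = 0"
  by (simp add: ev_def)

lemma ev_single: "ev h w (Poly_Mapping.single m c) = h c * mon_ev w m"
  by (subst ev_superset[of "{m}"]) auto

lemma ev_Const [simp]: "ev h w (Const c) = h c"
  by (simp add: Const_def ev_single)

lemma ev_one [simp]: "ev h w 1 = 1"
  using ev_Const[of w 1] by simp

lemma ev_pvar [simp]: "ev h w (pvar v) = w v"
  by (simp add: pvar_def ev_single mon_ev_def)

lemma ev_add: "ev h w (p + q) = ev h w p + ev h w q"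
proof -
  let ?X = "Poly_Mapping.keys p \<union> Poly_Mapping.keys q"
  have "ev h w p = (\<Sum>m\<in>?X. h (Poly_Mapping.lookup p m) * mon_ev w m)"
    by (rule ev_superset) auto
  moreover have "ev h w q = (\<Sum>m\<in>?X. h (Poly_Mapping.lookup q m) * mon_ev w m)"
    by (rule ev_superset) auto
  moreover have "ev h w (p + q) = (\<Sum>m\<in>?X. h (Poly_Mapping.lookup (p + q) m) * mon_ev w m)"
    using Poly_Mapping.keys_add[of p q] by (intro ev_superset) auto
  ultimately show ?thesis by (simp add: lookup_add h_add distrib_right sum.distrib)
qed

lemma ev_sum: "ev h w (sum f A) = (\<Sum>i\<in>A. ev h w (f i))"
  by (induction A rule: infinite_finite_induct) (auto simp: ev_add)

lemma ev_mult: "ev h w (p * q) = ev h w p * ev h w q"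
proof -
  let ?s = "\<lambda>p m. Poly_Mapping.single m (Poly_Mapping.lookup p m)"
  have "p * q = (\<Sum>m\<in>Poly_Mapping.keys p. \<Sum>n\<in>Poly_Mapping.keys q. ?s p m * ?s q n)"
    by (simp only: poly_mapping_sum_singles sum_product[symmetric])
  then have "ev h w (p * q) = (\<Sum>m\<in>Poly_Mapping.keys p. \<Sum>n\<in>Poly_Mapping.keys q.
      (h (Poly_Mapping.lookup p m) * mon_ev w m) * (h (Poly_Mapping.lookup q n) * mon_ev w n))"
    by (simp add: ev_sum mult_single ev_single h_mult mon_ev_add ac_simps)
  then show ?thesis by (simp add: ev_def sum_product)
qed

lemma ev_diff: "ev h w (p - q) = ev h w p - ev h w q"
  using ev_add[of w "p - q" q] by simp

lemma poly_ideal_kernel: "poly_ideal V {p \<in> polys V. ev h w p = 0}"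
  by (auto simp: poly_ideal_def ev_add ev_mult)

end

lemma single_power: "Poly_Mapping.single (Poly_Mapping.single v n) (1::'k::field) = pvar v ^ n"
proof (induction n)
  case (Suc n)
  have "pvar v ^ Suc n = pvar v * Poly_Mapping.single (Poly_Mapping.single v n) (1::'k)"
    using Suc by simp
  then show ?case by (simp add: pvar_def mult_single flip: single_add)
qed simp

lemma single_sum:
  "Poly_Mapping.single (sum g A) (1::'k::field) = (\<Prod>i\<in>A. Poly_Mapping.single (g i) 1)"
proof (induction A rule: infinite_finite_induct)
  case (insert x A)
  then show ?case by (simp add: mult_single flip: insert.IH)
qed auto

lemma single_eq_prod_pvar:
  "Poly_Mapping.single m (1::'k::field) = (\<Prod>v\<in>Poly_Mapping.keys m. pvar v ^ Poly_Mapping.lookup m v)"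
proof -
  have "Poly_Mapping.single m (1::'k) =
      Poly_Mapping.single (\<Sum>v\<in>Poly_Mapping.keys m. Poly_Mapping.single v (Poly_Mapping.lookup m v)) 1"
    by (simp only: poly_mapping_sum_singles)
  then show ?thesis by (simp only: single_sum single_power)
qed

lemma polys_induct [consumes 1, case_names Const pvar add mult]:
  fixes p :: "'k::field mpoly"
  assumes p: "p \<in> polys V"
    and Const: "\<And>c. P (Const c)" and pvar: "\<And>v. v \<in> V \<Longrightarrow> P (pvar v)"
    and add: "\<And>p q. P p \<Longrightarrow> P q \<Longrightarrow> P (p + q)"
    and mult: "\<And>p q. P p \<Longrightarrow> P q \<Longrightarrow> P (p * q)"
  shows "P p"
proof -
  have one: "P 1" using Const[of 1] by simp
  have power: "P (q ^ n)" if "P q" for q n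
    by (induction n) (auto simp: one intro: mult that)
  have prod: "P (\<Prod>i\<in>A. f i)" if "\<And>i. i \<in> A \<Longrightarrow> P (f i)" for A and f :: "point \<Rightarrow> 'k mpoly"
    using that by (induction A rule: infinite_finite_induct) (auto simp: one intro: mult)
  have single: "P (Poly_Mapping.single m c)" if "Poly_Mapping.keys m \<subseteq> V" for m c
  proof -
    have "P (Const c * Poly_Mapping.single m 1)"
      unfolding single_eq_prod_pvar using that by (intro mult Const prod power pvar) auto
    then show ?thesis by (simp add: Const_def mult_single)
  qed
  have "P (\<Sum>m\<in>A. Poly_Mapping.single m (Poly_Mapping.lookup p m))"
    if "A \<subseteq> Poly_Mapping.keys p" for A
    using that
  proof (induction A rule: infinite_finite_induct)
    case (insert m A)
    then show ?case using p single[of m] by (auto simp: polys_iff intro!: add)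
  qed (use Const[of 0] in auto)
  from this[OF subset_refl] show ?thesis by (simp only: poly_mapping_sum_singles)
qed

section \<open>Evaluation in the polynomial ring and in its field of fractions\<close>

definition to_fract :: "'k::field mpoly \<Rightarrow> 'k mpoly fract" where
  "to_fract p = Fract p 1"

lemma to_fract_simps [simp]:
  "to_fract 0 = 0" "to_fract 1 = 1" "to_fract (p + q) = to_fract p + to_fract q" "to_fract (p * q) = to_fract p * to_fract q"
  by (simp_all add: to_fract_def Zero_fract_def One_fract_def)

lemma to_fract_eq_0_iff [simp]: "to_fract p = 0 \<longleftrightarrow> p = 0"
  by (simp add: to_fract_def Zero_fract_def eq_fract)

interpretation C: coeff_hom Const
  by unfold_locales (simp_all add: Const_add Const_mult)

interpretation F: coeff_hom "\<lambda>c. to_fract (Const c)"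
  by unfold_locales (simp_all add: Const_add Const_mult)

abbreviation fev :: "(point \<Rightarrow> 'k::field mpoly fract) \<Rightarrow> 'k mpoly \<Rightarrow> 'k mpoly fract" where
  "fev \<equiv> ev (\<lambda>c. to_fract (Const c))"

lemma fev_frac:
  assumes "p \<in> polys V" "\<And>v. v \<in> V \<Longrightarrow> w v = to_fract (\<beta> v)"
  shows "fev w p = to_fract (ev Const \<beta> p)"
  using assms(1) by (induction p rule: polys_induct) (simp_all add: assms(2) F.ev_add F.ev_mult C.ev_add C.ev_mult)

lemma ev_ev:
  assumes "p \<in> polys V"
  shows "ev Const \<sigma> (ev Const \<beta> p) = ev Const (\<lambda>v. ev Const \<sigma> (\<beta> v)) p"
  using assms by (induction p rule: polys_induct) (simp_all add: C.ev_add C.ev_mult)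

lemma ev_pvar_id: "p \<in> polys V \<Longrightarrow> ev Const pvar p = p"
  by (induction p rule: polys_induct) (simp_all add: C.ev_add C.ev_mult)

lemma fev_frac_pvar:
  assumes "p \<in> polys V" "\<And>v. v \<in> V \<Longrightarrow> w v = to_fract (pvar v)"
  shows "fev w p = to_fract p"
  using fev_frac[OF assms] ev_pvar_id[OF assms(1)] by simp

lemma pvar_nonzero [simp]: "pvar v \<noteq> (0 :: 'k::field mpoly)"
proof
  assume "pvar v = (0 :: 'k mpoly)"
  then have "Poly_Mapping.lookup (pvar v :: 'k mpoly) (Poly_Mapping.single v 1) = 0" by simp
  then show False by (simp add: pvar_def)
qed

text \<open>The ideal of polynomials vanishing at a point with coordinates in the field of
  fractions. It is prime because the values lie in a field; all primes constructed below have this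
  form.\<close>

definition ker :: "point set \<Rightarrow> (point \<Rightarrow> 'k::field mpoly fract) \<Rightarrow> 'k mpoly set" where
  "ker V w = {p \<in> polys V. fev w p = 0}"

lemma ker_ideal: "poly_ideal V (ker V w)"
  unfolding ker_def by (rule F.poly_ideal_kernel)

lemma ker_prime: "primeideal (ker V w) (poly_ring V)"
  using ker_ideal[of V w] by (auto simp: primeideal_iff ker_def F.ev_mult)


section \<open>Elimination of the upper right corners\<close>

text \<open>Collections of cells are represented by the set \<open>D\<close> of lower left corners. Modulo the
  minors the variable of the upper right corner of a cell is a quotient of monomials in the
  variables of the other corners, all of which are lexicographically smaller.\<close>

definition lead :: "point set \<Rightarrow> point set" where
  "lead D = (\<lambda>(i, j). (i + 1, j + 1)) ` D"

definition verts :: "point set \<Rightarrow> point set" where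
  "verts D = (\<Union>(i, j)\<in>D. cell i j)"

definition minors :: "point set \<Rightarrow> 'k::field mpoly set" where
  "minors D = (\<lambda>(i, j). adj_minor i j) ` D"

definition monomials :: "point set \<Rightarrow> 'k::field mpoly set" where
  "monomials U = (\<lambda>m. Poly_Mapping.single m 1) ` {m. Poly_Mapping.keys m \<subseteq> U}"

lemma monomials_one: "1 \<in> monomials U"
  unfolding monomials_def by (rule image_eqI[of _ _ 0]) auto

lemma monomials_mult: "p \<in> monomials U \<Longrightarrow> q \<in> monomials U \<Longrightarrow> p * q \<in> monomials U"
  unfolding monomials_def
proof (elim imageE)
  fix m n assume *: "p = Poly_Mapping.single m 1" "q = Poly_Mapping.single n 1"
    "m \<in> {m. Poly_Mapping.keys m \<subseteq> U}" "n \<in> {m. Poly_Mapping.keys m \<subseteq> U}"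
  then show "p * q \<in> (\<lambda>m. Poly_Mapping.single m 1) ` {m. Poly_Mapping.keys m \<subseteq> U}"
    by (intro image_eqI[of _ _ "m + n"]) (simp_all add: mult_single keys_add_nat)
qed

lemma monomials_mono: "U \<subseteq> W \<Longrightarrow> p \<in> monomials U \<Longrightarrow> p \<in> monomials W"
  unfolding monomials_def by auto

lemma monomials_pvar: "v \<in> U \<Longrightarrow> pvar v \<in> monomials U"
  unfolding monomials_def pvar_def by (rule imageI) simp

lemma monomials_polys: "p \<in> monomials U \<Longrightarrow> p \<in> polys U"
  unfolding monomials_def by (auto intro: polys_single)

lemma fev_mono_nonzero:
  assumes "p \<in> monomials U" "\<And>v. v \<in> U \<Longrightarrow> w v \<noteq> 0"
  shows "fev w p \<noteq> 0"
proof -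
  obtain m where m: "p = Poly_Mapping.single m 1" "Poly_Mapping.keys m \<subseteq> U"
    using assms(1) by (auto simp: monomials_def)
  then have "w v \<noteq> 0" if "v \<in> Poly_Mapping.keys m" for v using assms(2) that by blast
  then show ?thesis by (simp add: m(1) F.ev_single mon_ev_def)
qed

lemma minors_polys: "verts D \<subseteq> V \<Longrightarrow> minors D \<subseteq> polys V"
  by (fastforce simp: minors_def verts_def adj_minor_def cell_def intro!: polys_diff polys_mult)

lemma lead_subset_verts: "lead D \<subseteq> verts D"
  by (force simp: lead_def verts_def cell_def)

lemma verts_insert: "verts (insert (i, j) A) = cell i j \<union> verts A"
  by (simp add: verts_def)

lemma lead_insert: "lead (insert (i, j) A) = insert (i + 1, j + 1) (lead A)"
  by (simp add: lead_def)

lemma minors_insert: "minors (insert (i, j) A) = insert (adj_minor i j) (minors A)"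
  by (simp add: minors_def)

text \<open>The upper right corner is the lexicographically largest vertex of a cell, and it grows
  with the lower left corner. So adding cells in increasing order brings a new upper right corner
  each time.\<close>

lemma lead_fresh: "\<forall>a\<in>A. a < (i, j) \<Longrightarrow> (i + 1, j + 1) \<notin> verts A"
  by (fastforce simp: verts_def cell_def)

text \<open>Induction over the cells in increasing order. Only the upper right corner of the newest
  cell is new; the other three corners are already eliminated, and the minor gives the fourth.
  Inserting \<open>v\<close> in the second set allows for a variable outside the vertices of
  \<open>D\<close>.\<close>

lemma eliminate_var:
  assumes "finite D" "verts D \<subseteq> V" "v \<in> V"
  shows "\<exists>m\<in>monomials (verts D - lead D). \<exists>m'\<in>monomials (insert v (verts D) - lead D).
    m * pvar v - m' \<in> gen V (minors D :: 'k::field mpoly set)"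
  using assms
proof (induction D arbitrary: v rule: finite_linorder_max_induct)
  case empty
  have "poly_ideal V (gen V (minors {} :: 'k mpoly set))"
    by (rule poly_ideal_gen) (simp add: minors_def)
  then have "1 * pvar v - pvar v \<in> gen V (minors {} :: 'k mpoly set)" by (simp add: poly_idealD)
  then show ?case using monomials_one monomials_pvar[of v "insert v (verts {}) - lead {}"]
    by (fastforce simp: lead_def)
next
  case (insert c A)
  obtain i j where c: "c = (i, j)" by (cases c)
  let ?D = "insert c A" and ?l = "(i + 1, j + 1)"
  let ?I = "gen V (minors ?D :: 'k mpoly set)"
  have D: "cell i j \<subseteq> V" "verts A \<subseteq> V" using insert.prems(1) by (auto simp: c verts_insert)
  have l: "?l \<notin> verts A" using insert.hyps(2) unfolding c by (rule lead_fresh)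
  have sub1: "verts A - lead A \<subseteq> verts ?D - lead ?D"
    using l by (auto simp: c verts_insert lead_insert)
  have sub2: "insert u (verts A) - lead A \<subseteq> insert u (verts ?D) - lead ?D" if "u \<noteq> ?l" for u
    using l that by (auto simp: c verts_insert lead_insert)
  have sub3: "insert u (verts ?D) = verts ?D" if "u \<in> cell i j" for u
    using that by (auto simp: c verts_insert)
  have gen: "gen V (minors A) \<subseteq> ?I" by (rule gen_mono) (auto simp: c minors_insert)
  have I: "poly_ideal V ?I" by (rule poly_ideal_gen[OF minors_polys[OF insert.prems(1)]])
  have IH: "\<exists>m\<in>monomials (verts ?D - lead ?D). \<exists>m'\<in>monomials (insert u (verts ?D) - lead ?D).
      m * pvar u - m' \<in> ?I" if u: "u \<in> V" "u \<noteq> ?l" for u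
    using insert.IH[OF D(2) u(1)] monomials_mono[OF sub1] monomials_mono[OF sub2[OF u(2)]] gen by blast
  show ?case
  proof (cases "v = ?l")
    case False
    then show ?thesis by (rule IH[OF insert.prems(2)])
  next
    case True
    let ?M = "monomials (verts ?D - lead ?D) :: 'k mpoly set"
    have IH': "\<exists>m\<in>?M. \<exists>m'\<in>?M. m * pvar u - m' \<in> ?I" if "u \<in> cell i j" "u \<noteq> ?l" for u
      using IH[of u] that D(1) sub3[OF that(1)] by auto
    obtain ma a' where a: "ma \<in> ?M" "a' \<in> ?M" "ma * pvar (i, j) - a' \<in> ?I"
      using IH'[of "(i, j)"] by (auto simp: cell_def)
    obtain mc c' where c': "mc \<in> ?M" "c' \<in> ?M" "mc * pvar (i, j + 1) - c' \<in> ?I"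
      using IH'[of "(i, j + 1)"] by (auto simp: cell_def)
    obtain md d' where d: "md \<in> ?M" "d' \<in> ?M" "md * pvar (i + 1, j) - d' \<in> ?I"
      using IH'[of "(i + 1, j)"] by (auto simp: cell_def)
    have M: "p \<in> polys V" if "p \<in> ?M" for p
      by (rule polys_mono[of "verts ?D - lead ?D"]) (use monomials_polys[OF that] insert.prems(1) in auto)
    have V: "pvar u \<in> polys V" if "u \<in> cell i j" for u using that D(1) by auto
    have minor: "adj_minor i j \<in> ?I" using gen_superset[of "minors ?D" V] by (auto simp: c minors_insert)
    \<comment> \<open>The minor is multiplied by the three denominators \<open>ma\<close>,
      \<open>mc\<close>, \<open>md\<close>, and the products \<open>ma * pvar (i, j)\<close> and so
      on are replaced by \<open>a'\<close>, \<open>c'\<close>, \<open>d'\<close>.\<close>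
    have "a' * mc * md * pvar ?l - c' * d' * ma =
      ma * mc * md * adj_minor i j - mc * md * pvar ?l * (ma * pvar (i, j) - a') +
      (ma * md * pvar (i + 1, j)) * (mc * pvar (i, j + 1) - c') +
      ma * c' * (md * pvar (i + 1, j) - d')"
      by (simp add: adj_minor_def algebra_simps)
    also have "\<dots> \<in> ?I"
      by (intro poly_idealD(3)[OF I] poly_ideal_diff[OF I] poly_idealD(4)[OF I _ minor]
          poly_idealD(4)[OF I _ a(3)] poly_idealD(4)[OF I _ c'(3)] poly_idealD(4)[OF I _ d(3)]
          polys_mult M a(1,2) c'(1,2) d(1,2) V) (auto simp: cell_def)
    finally have "a' * mc * md * pvar ?l - c' * d' * ma \<in> ?I" .
    moreover have "a' * mc * md \<in> ?M" "c' * d' * ma \<in> ?M"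
      using a c' d by (auto intro!: monomials_mult)
    moreover have "insert v (verts ?D) = verts ?D" by (rule sub3) (simp add: True cell_def)
    ultimately show ?thesis unfolding True by auto
  qed
qed

text \<open>Once variables are eliminated, sums are handled by a common monomial denominator and
  products by multiplying denominators.\<close>

lemma eliminate:
  fixes f :: "'k::field mpoly"
  assumes D: "finite D" "verts D \<subseteq> V" and f: "f \<in> polys V"
  shows "\<exists>m\<in>monomials (verts D - lead D). \<exists>f'\<in>polys (V - lead D). m * f - f' \<in> gen V (minors D)"
  using f
proof (induction f rule: polys_induct)
  case (Const c)
  have "1 * Const c - Const c \<in> gen V (minors D)"
    by (simp add: poly_idealD(2)[OF poly_ideal_gen[OF minors_polys[OF D(2)]]])
  then show ?case using monomials_one polys_Const by blast
next
  case (pvar v)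
  have "p \<in> polys (V - lead D)" if "p \<in> monomials (insert v (verts D) - lead D)" for p :: "'k mpoly"
    using monomials_polys[OF that] D(2) pvar by (rule_tac polys_mono) auto
  with eliminate_var[OF D pvar] show ?case by blast
next
  case (add p q)
  note I = poly_ideal_gen[OF minors_polys[OF D(2)]]
  obtain m p' where p: "m \<in> monomials (verts D - lead D)" "p' \<in> polys (V - lead D)"
    "m * p - p' \<in> gen V (minors D)" using add.IH(1) by blast
  obtain n q' where q: "n \<in> monomials (verts D - lead D)" "q' \<in> polys (V - lead D)"
    "n * q - q' \<in> gen V (minors D)" using add.IH(2) by blast
  have mn: "m \<in> polys (V - lead D)" "n \<in> polys (V - lead D)"
    using monomials_polys[OF p(1)] monomials_polys[OF q(1)] D(2) by (auto elim!: polys_mono[rotated])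
  then have mn': "m \<in> polys V" "n \<in> polys V" by (auto elim!: polys_mono[rotated])
  have "m * n * (p + q) - (n * p' + m * q') = n * (m * p - p') + m * (n * q - q')"
    by (simp add: algebra_simps)
  also have "\<dots> \<in> gen V (minors D)"
    by (intro poly_idealD(3)[OF I] poly_idealD(4)[OF I _ p(3)] poly_idealD(4)[OF I _ q(3)] mn')
  finally have "m * n * (p + q) - (n * p' + m * q') \<in> gen V (minors D)" .
  moreover have "n * p' + m * q' \<in> polys (V - lead D)" using mn p q by simp
  ultimately show ?case using monomials_mult[OF p(1) q(1)] by blast
next
  case (mult p q)
  note I = poly_ideal_gen[OF minors_polys[OF D(2)]]
  obtain m p' where p: "m \<in> monomials (verts D - lead D)" "p' \<in> polys (V - lead D)"
    "m * p - p' \<in> gen V (minors D)" using mult.IH(1) by blast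
  obtain n q' where q: "n \<in> monomials (verts D - lead D)" "q' \<in> polys (V - lead D)"
    "n * q - q' \<in> gen V (minors D)" using mult.IH(2) by blast
  have pq: "p' \<in> polys V" "q' \<in> polys V" using p(2) q(2) by (auto elim!: polys_mono[rotated])
  have "m * n * (p * q) - p' * q' = (m * p - p') * (n * q - q') + q' * (m * p - p') + p' * (n * q - q')"
    by (simp add: algebra_simps)
  also have "\<dots> \<in> gen V (minors D)"
    by (intro poly_idealD(3)[OF I] poly_idealD(4)[OF I _ p(3)] poly_idealD(4)[OF I _ q(3)] pq
        poly_idealD(1)[OF I p(3)])
  finally have "m * n * (p * q) - p' * q' \<in> gen V (minors D)" .
  moreover have "p' * q' \<in> polys (V - lead D)" using p q by simp
  ultimately show ?case using monomials_mult[OF p(1) q(1)] by blast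
qed

text \<open>A common zero of the minors with nonzero coordinates at the vertices, so that monomials
  can be cancelled and upper right corners solved for.\<close>

definition solves :: "point set \<Rightarrow> (point \<Rightarrow> 'b::field) \<Rightarrow> bool" where
  "solves D w \<longleftrightarrow> (\<forall>(i, j)\<in>D. w (i, j) * w (i + 1, j + 1) = w (i, j + 1) * w (i + 1, j)) \<and>
     (\<forall>v\<in>verts D. w v \<noteq> 0)"

text \<open>The upper right corner of the largest cell is no vertex of the other cells, so its value
  can be defined by the relation of that cell without disturbing the earlier ones. The values
  outside \<open>lead D\<close> serve as free coordinates.\<close>

lemma solves_exists:
  fixes \<beta> :: "point \<Rightarrow> 'b::field"
  assumes "finite D" "\<And>v. v \<in> verts D \<Longrightarrow> \<beta> v \<noteq> 0"
  shows "\<exists>w. solves D w \<and> (\<forall>v. v \<notin> lead D \<longrightarrow> w v = \<beta> v)"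
  using assms
proof (induction D rule: finite_linorder_max_induct)
  case empty
  then show ?case by (auto simp: solves_def verts_def)
next
  case (insert c A)
  obtain i j where c: "c = (i, j)" by (cases c)
  let ?l = "(i + 1, j + 1)"
  have l: "?l \<notin> verts A" using insert.hyps(2) unfolding c by (rule lead_fresh)
  have "\<And>v. v \<in> verts A \<Longrightarrow> \<beta> v \<noteq> 0" using insert.prems unfolding c verts_insert by auto
  from insert.IH[OF this] obtain w where w: "solves A w" "\<forall>v. v \<notin> lead A \<longrightarrow> w v = \<beta> v" by blast
  have nz: "w v \<noteq> 0" if "v \<in> cell i j" for v
  proof (cases "v \<in> verts A")
    case True
    then show ?thesis using w(1) by (auto simp: solves_def)
  next
    case False
    then have "w v = \<beta> v" using w(2) lead_subset_verts by blast
    then show ?thesis using insert.prems[of v] that by (simp add: c verts_insert)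
  qed
  define w' where "w' = w(?l := w (i, j + 1) * w (i + 1, j) / w (i, j))"
  have nz': "w (i, j) \<noteq> 0" "w (i, j + 1) \<noteq> 0" "w (i + 1, j) \<noteq> 0" by (rule nz, simp add: cell_def)+
  have eq: "w' v = w v" if "v \<noteq> ?l" for v using that by (simp add: w'_def)
  have eqA: "w' v = w v" if "v \<in> verts A" for v using that l by (intro eq) auto
  have "solves (insert c A) w'"
    unfolding solves_def
  proof (intro conjI ballI)
    fix e assume e: "e \<in> insert c A"
    obtain k n where kn: "e = (k, n)" by (cases e)
    have "w' (k, n) * w' (k + 1, n + 1) = w' (k, n + 1) * w' (k + 1, n)"
    proof (cases "e = c")
      case True
      then show ?thesis using nz' kn c by (auto simp: w'_def)
    next
      case False
      then have "e \<in> A" using e by auto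
      then have "cell k n \<subseteq> verts A" by (auto simp: verts_def kn)
      then show ?thesis using w(1) \<open>e \<in> A\<close> eqA kn by (auto simp: solves_def cell_def)
    qed
    then show "case e of (i, j) \<Rightarrow> w' (i, j) * w' (i + 1, j + 1) = w' (i, j + 1) * w' (i + 1, j)"
      by (simp add: kn)
  next
    fix v assume v: "v \<in> verts (insert c A)"
    show "w' v \<noteq> 0"
    proof (cases "v = ?l")
      case True
      then show ?thesis using nz' by (simp add: w'_def)
    next
      case False
      then show ?thesis using nz[of v] w(1) v eq[of v] by (auto simp: c verts_insert solves_def)
    qed
  qed
  moreover have "\<forall>v. v \<notin> lead (insert c A) \<longrightarrow> w' v = \<beta> v"
    using w(2) eq by (auto simp: c lead_insert)
  ultimately show ?case by blast
qed

lemma fev_minors: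
  assumes "\<forall>(i, j)\<in>D. w (i, j) * w (i + 1, j + 1) = w (i, j + 1) * w (i + 1, j)" "verts D \<subseteq> V"
  shows "gen V (minors D) \<subseteq> ker V w"
proof (rule gen_minimal[OF ker_ideal])
  show "minors D \<subseteq> ker V w"
    using minors_polys[OF assms(2)] assms(1)
    by (fastforce simp: minors_def ker_def adj_minor_def F.ev_diff F.ev_mult)
qed

text \<open>The monomial \<open>m\<close> does not vanish at \<open>w\<close> and can be cancelled.
  For \<open>f'\<close> from \<open>eliminate\<close>, membership in the kernel is thus decided by
  the free coordinates.\<close>

lemma ker_eliminate:
  assumes "solves D w" "verts D \<subseteq> V" and f: "f \<in> polys V" and m: "m \<in> monomials (verts D - lead D)"
    and e: "m * f - f' \<in> gen V (minors D)"
  shows "f \<in> ker V w \<longleftrightarrow> fev w f' = 0"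
proof -
  have "fev w (m * f - f') = 0"
    using fev_minors[of D w V] assms(1,2) e by (auto simp: solves_def ker_def)
  then have "fev w m * fev w f = fev w f'" by (simp add: F.ev_diff F.ev_mult)
  moreover have "fev w m \<noteq> 0"
    using assms(1) by (intro fev_mono_nonzero[OF m]) (auto simp: solves_def)
  ultimately show ?thesis using f by (auto simp: ker_def)
qed

text \<open>At the generic point the free coordinates are the variables themselves, so the
  eliminated form \<open>f'\<close> is zero as a polynomial. Hence the kernel lies in the saturation
  of the ideal of minors by monomials.\<close>

lemma generic_ker:
  assumes D: "finite D" "verts D \<subseteq> V" and w: "solves D w" "\<And>v. v \<in> V - lead D \<Longrightarrow> w v = to_fract (pvar v)"
    and f: "f \<in> ker V w"
  shows "\<exists>m\<in>monomials (verts D - lead D). m * f \<in> gen V (minors D)"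
proof -
  have fV: "f \<in> polys V" using f by (simp add: ker_def)
  from eliminate[OF D fV] obtain m f' where *: "m \<in> monomials (verts D - lead D)" "f' \<in> polys (V - lead D)"
    "m * f - f' \<in> gen V (minors D)" by blast
  have "fev w f' = 0" using ker_eliminate[OF w(1) D(2) fV *(1,3)] f by simp
  then have "f' = 0" using fev_frac_pvar[OF *(2) w(2)] by simp
  with * show ?thesis by auto
qed


section \<open>Chains of toric primes\<close>

lemma solves_mono: "solves D w \<Longrightarrow> A \<subseteq> D \<Longrightarrow> solves A w"
  unfolding solves_def verts_def by blast

lemma solves_cong:
  assumes "solves D w" "\<And>v. v \<in> verts D \<Longrightarrow> w' v = w v"
  shows "solves D w'"
  unfolding solves_def
proof (intro conjI ballI)
  fix e assume "e \<in> D"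
  moreover obtain i j where "e = (i, j)" by (cases e)
  moreover from calculation have "cell i j \<subseteq> verts D" by (auto simp: verts_def)
  ultimately show "case e of (i, j) \<Rightarrow> w' (i, j) * w' (i + 1, j + 1) = w' (i, j + 1) * w' (i + 1, j)"
    using assms by (auto simp: solves_def cell_def)
qed (use assms in \<open>auto simp: solves_def\<close>)

text \<open>By \<open>generic_ker\<close> some monomial multiple of \<open>f\<close> lies in the
  ideal of minors, and the monomial is nonzero at \<open>w'\<close>.\<close>

lemma generic_ker_least:
  assumes D: "finite D" "verts D \<subseteq> V" and w: "solves D w" "\<And>v. v \<in> V - lead D \<Longrightarrow> w v = to_fract (pvar v)"
    and w': "solves D w'"
  shows "ker V w \<subseteq> ker V w'"
proof
  fix f assume f: "f \<in> ker V w"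
  obtain m where m: "m \<in> monomials (verts D - lead D)" "m * f \<in> gen V (minors D)"
    using generic_ker[OF D w f] by blast
  have fV: "f \<in> polys V" using f by (simp add: ker_def)
  show "f \<in> ker V w'" using ker_eliminate[OF w' D(2) fV m(1), of 0] m(2) by simp
qed

text \<open>Adding the cells in increasing order enlarges the generic kernel strictly at each step;
  this is the lower bound for the height.\<close>

lemma generic_ker_chain:
  fixes w :: "point \<Rightarrow> 'k::field mpoly fract"
  assumes "finite D" "verts D \<subseteq> V" "solves D w" "\<And>v. v \<notin> lead D \<Longrightarrow> w v = to_fract (pvar v)"
  shows "\<exists>Q. prime_chain (poly_ring V) (card D) Q \<and> Q (card D) = ker V w"
  using assms
proof (induction D arbitrary: w rule: finite_linorder_max_induct)
  case empty
  then show ?case by (intro exI[of _ "\<lambda>_. ker V w"]) (simp add: prime_chain_def ker_prime)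
next
  case (insert c A)
  obtain i j where c: "c = (i, j)" by (cases c)
  let ?l = "(i + 1, j + 1)"
  have l: "?l \<notin> verts A" using insert.hyps(2) unfolding c by (rule lead_fresh)
  have V: "verts A \<subseteq> V" "cell i j \<subseteq> V" using insert.prems(1) by (auto simp: c verts_insert)
  obtain w0 where w0: "solves A w0" "\<forall>v. v \<notin> lead A \<longrightarrow> w0 v = to_fract (pvar v :: 'k mpoly)"
    using solves_exists[OF insert.hyps(1), of "\<lambda>v. to_fract (pvar v)"] by auto
  obtain Q where Q: "prime_chain (poly_ring V) (card A) Q" "Q (card A) = ker V w0"
    using insert.IH[OF V(1) w0(1)] w0(2) by auto
  have sub: "ker V w0 \<subseteq> ker V w"
  proof (rule generic_ker_least[OF insert.hyps(1) V(1) w0(1)])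
    show "solves A w" using insert.prems(2) by (rule solves_mono) auto
  qed (use w0(2) in auto)
  have nz: "w0 v \<noteq> 0" for v
  proof (cases "v \<in> verts A")
    case True
    then show ?thesis using w0(1) by (simp add: solves_def)
  next
    case False
    then have "w0 v = to_fract (pvar v)" using w0(2) lead_subset_verts[of A] by blast
    then show ?thesis by simp
  qed
  \<comment> \<open>The new corner is no vertex of \<open>A\<close>, so setting it to zero still
    solves \<open>A\<close>, but the new minor becomes minus a product of two nonzero values. As
    \<open>ker V w0\<close> is least, it cannot contain that minor.\<close>
  define w1 where "w1 = w0(?l := 0)"
  have "solves A w1" by (rule solves_cong[OF w0(1)]) (use l in \<open>auto simp: w1_def\<close>)
  then have "ker V w0 \<subseteq> ker V w1"
    using generic_ker_least[OF insert.hyps(1) V(1) w0(1)] w0(2) by auto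
  moreover have "fev w1 (adj_minor i j) \<noteq> 0"
    using nz[of "(i, j + 1)"] nz[of "(i + 1, j)"]
    by (simp add: adj_minor_def F.ev_diff F.ev_mult w1_def)
  ultimately have "adj_minor i j \<notin> ker V w0" by (auto simp: ker_def)
  moreover have "minors (insert c A) \<subseteq> ker V w"
    using fev_minors[of "insert c A" w V] insert.prems(1,2) gen_superset[of "minors (insert c A)" V]
    by (auto simp: solves_def)
  then have "adj_minor i j \<in> ker V w" by (simp add: c minors_insert)
  ultimately have strict: "ker V w0 \<subset> ker V w" using sub by blast
  have "c \<notin> A" using insert.hyps(2) by auto
  then have card: "card (insert c A) = Suc (card A)" using insert.hyps(1) by simp
  have "prime_chain (poly_ring V) (Suc (card A)) (Q(Suc (card A) := ker V w))"
    using Q strict by (auto simp: prime_chain_def le_Suc_eq less_Suc_eq ker_prime)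
  then show ?case unfolding card by (intro exI conjI) (assumption, simp)
qed

text \<open>Specializing the free variables to \<open>1\<close> one after the other gives a chain above the
  prime ideal where only the variables in \<open>Z\<close> vanish.\<close>

definition spec :: "point set \<Rightarrow> point set \<Rightarrow> point \<Rightarrow> 'k::field mpoly" where
  "spec Z Y v = (if v \<in> Z then 0 else if v \<in> Y then 1 else pvar v)"

text \<open>Reduced by \<open>eliminate\<close> to variables outside \<open>lead D\<close>, an
  element of a kernel becomes a polynomial that vanishes under the substitution \<open>spec\<close>;
  setting one more variable to \<open>1\<close> keeps it zero.\<close>

lemma spec_chain:
  fixes V :: "point set" and w :: "nat \<Rightarrow> point \<Rightarrow> 'k::field mpoly fract"
  assumes D: "finite D" "verts D \<subseteq> V"
    and ts: "distinct ts" "set ts \<subseteq> V - Z - lead D"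
    and w: "\<And>n. solves D (w n)" "\<And>n v. v \<notin> lead D \<Longrightarrow> w n v = to_fract (spec Z (set (take n ts)) v)"
  shows "prime_chain (poly_ring V) (length ts) (\<lambda>n. ker V (w n))"
  unfolding prime_chain_def
proof (intro conjI allI impI)
  fix n assume n: "n < length ts"
  let ?t = "ts ! n"
  let ?\<beta> = "\<lambda>n. spec Z (set (take n ts)) :: point \<Rightarrow> 'k mpoly"
  have t: "?t \<in> V" "?t \<notin> Z" "?t \<notin> lead D" using ts(2) nth_mem[OF n] by auto
  have tn: "?t \<notin> set (take n ts)"
    using ts(1) n by (auto simp: in_set_conv_nth nth_eq_iff_index_eq)
  have take: "set (take (Suc n) ts) = insert ?t (set (take n ts))"
    using n by (simp add: take_Suc_conv_app_nth)
  \<comment> \<open>The substitution that turns each specialization into the next one.\<close>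
  let ?\<sigma> = "pvar(?t := 1) :: point \<Rightarrow> 'k mpoly"
  have \<sigma>: "ev Const ?\<sigma> (?\<beta> n v) = ?\<beta> (Suc n) v" for v
    using tn t(2) by (auto simp: spec_def take)
  have sub: "f \<in> ker V (w (Suc n))" if f: "f \<in> ker V (w n)" for f
  proof -
    have fV: "f \<in> polys V" using f by (simp add: ker_def)
    from eliminate[OF D fV] obtain m f' where *: "m \<in> monomials (verts D - lead D)"
      "f' \<in> polys (V - lead D)" "m * f - f' \<in> gen V (minors D)" by blast
    have eq: "fev (w k) f' = to_fract (ev Const (?\<beta> k) f')" for k
      by (rule fev_frac[OF *(2)]) (use w(2) in auto)
    have "ev Const (?\<beta> n) f' = 0"
      using ker_eliminate[OF w(1) D(2) fV *(1,3), of n] f eq[of n] by simp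
    then have "ev Const (?\<beta> (Suc n)) f' = 0"
      using ev_ev[OF *(2), of ?\<sigma> "?\<beta> n"] by (simp add: \<sigma>)
    then show ?thesis using ker_eliminate[OF w(1) D(2) fV *(1,3), of "Suc n"] eq[of "Suc n"] by simp
  qed
  \<comment> \<open>The inclusion is strict because of \<open>pvar ?t - 1\<close>: the variable is
    specialized to \<open>1\<close> at stage \<open>Suc n\<close> but still free at stage
    \<open>n\<close>.\<close>
  have "w (Suc n) ?t = 1" using w(2)[OF t(3)] t(2) by (simp add: spec_def take)
  then have "pvar ?t - 1 \<in> ker V (w (Suc n))" using t(1) by (simp add: ker_def F.ev_diff)
  moreover have "pvar ?t \<noteq> (1 :: 'k mpoly)"
  proof
    assume "pvar ?t = (1 :: 'k mpoly)"
    then have "ev Const (\<lambda>_. 0) (pvar ?t) = ev Const (\<lambda>_. 0 :: 'k mpoly) 1" by (rule arg_cong)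
    then show False by simp
  qed
  then have "to_fract (pvar ?t - 1 :: 'k mpoly) \<noteq> 0" by (simp only: to_fract_eq_0_iff) simp
  then have "to_fract (pvar ?t :: 'k mpoly) - 1 \<noteq> 0" by (simp add: to_fract_def One_fract_def)
  then have "pvar ?t - 1 \<notin> ker V (w n)"
    using w(2)[OF t(3), of n] t(2) tn by (simp add: ker_def F.ev_diff spec_def)
  ultimately show "ker V (w n) \<subset> ker V (w (Suc n))" using sub by blast
qed (rule ker_prime)

section \<open>Independence of distinct variables\<close>

primrec mexp :: "point list \<Rightarrow> nat list \<Rightarrow> (point \<Rightarrow>\<^sub>0 nat)" where
  "mexp [] as = 0"
| "mexp (t # ts) as = Poly_Mapping.single t (hd as) + mexp ts (tl as)"

lemma mval_pvar: "mval (map pvar ts) as = Poly_Mapping.single (mexp ts as) 1"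
  by (induction ts arbitrary: as) (simp_all add: mult_single flip: single_power)

lemma keys_mexp: "Poly_Mapping.keys (mexp ts as) \<subseteq> set ts"
  by (induction ts arbitrary: as) (auto simp: keys_add_nat split: if_splits)

lemma inj_mexp:
  assumes "distinct ts" "length as = length ts" "length bs = length ts" "mexp ts as = mexp ts bs"
  shows "as = bs"
  using assms
proof (induction ts arbitrary: as bs)
  case (Cons t ts)
  obtain a as' b bs' where ab: "as = a # as'" "bs = b # bs'"
    using Cons.prems(2,3) by (metis length_Suc_conv)
  have t: "Poly_Mapping.lookup (mexp ts xs) t = 0" for xs
    using keys_mexp[of ts xs] Cons.prems(1) by (auto simp: in_keys_iff)
  have "Poly_Mapping.lookup (mexp (t # ts) as) t = Poly_Mapping.lookup (mexp (t # ts) bs) t"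
    using Cons.prems(4) by simp
  then have "a = b" by (simp add: ab lookup_add t)
  then have "mexp ts as' = mexp ts bs'" using Cons.prems(4) by (simp add: ab)
  then show ?case using Cons.IH[of as' bs'] Cons.prems(1-3) \<open>a = b\<close> by (simp add: ab)
qed simp

text \<open>Power products of distinct variables are distinct monomials, so the coefficients of a
  relation can be read off from the polynomial.\<close>

lemma indep_pvars:
  assumes ts: "distinct ts" and J: "\<And>p. p \<in> polys (set ts) \<Longrightarrow> p \<in> J \<Longrightarrow> p = 0"
  shows "indep J (map pvar ts)"
  unfolding indep_def
proof (intro allI impI ballI)
  fix A and c :: "nat list \<Rightarrow> 'a" and as
  assume A: "finite A" "\<forall>as\<in>A. length as = length (map pvar ts :: 'a mpoly list)" and as: "as \<in> A"
    and rel: "(\<Sum>as\<in>A. Const (c as) * mval (map pvar ts) as) \<in> J"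
  have monomials_eq: "Const (c as) * mval (map pvar ts) as = Poly_Mapping.single (mexp ts as) (c as)" for as
    by (simp add: mval_pvar Const_def mult_single)
  have "(\<Sum>as\<in>A. Const (c as) * mval (map pvar ts) as) \<in> polys (set ts)"
    unfolding monomials_eq by (intro polys_sum polys_single keys_mexp)
  then have "(\<Sum>as\<in>A. Const (c as) * mval (map pvar ts) as) = 0" using rel J by blast
  then have "0 = Poly_Mapping.lookup (\<Sum>bs\<in>A. Poly_Mapping.single (mexp ts bs) (c bs)) (mexp ts as)"
    unfolding monomials_eq by simp
  also have "\<dots> = (\<Sum>bs\<in>A. if bs = as then c bs else 0)"
    unfolding lookup_sum
  proof (rule sum.cong)
    fix bs assume "bs \<in> A"
    then have "mexp ts bs = mexp ts as \<longleftrightarrow> bs = as" using inj_mexp[OF ts, of bs as] A(2) as by auto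
    then show "Poly_Mapping.lookup (Poly_Mapping.single (mexp ts bs) (c bs)) (mexp ts as) =
        (if bs = as then c bs else 0)"
      by (simp add: lookup_single when_def)
  qed simp
  also have "\<dots> = c as" using A(1) as by simp
  finally show "c as = 0" by simp
qed


section \<open>Heights, minimal primes and quotients\<close>

lemma prime_chain_height: "prime_chain R n Q \<Longrightarrow> enat n \<le> prime_height R (Q n)"
  unfolding prime_height_def by (rule Sup_upper) auto

lemma prime_height_le:
  assumes "\<And>n Q. prime_chain R n Q \<Longrightarrow> Q n = P \<Longrightarrow> n \<le> k"
  shows "prime_height R P \<le> enat k"
  unfolding prime_height_def using assms by (intro Sup_least) auto

text \<open>Chains ending in \<open>P\<close> are extended by \<open>P'\<close>. The finite bound
  makes the set of chain lengths finite, so the supremum is attained and the inequality stays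
  strict.\<close>

lemma prime_height_strict_mono:
  assumes "primeideal P R" "primeideal P' R" "P \<subset> P'" "prime_height R P' \<le> enat k"
  shows "prime_height R P < prime_height R P'"
proof -
  let ?S = "{n. \<exists>Q. prime_chain R n Q \<and> Q n = P}"
  have ext: "enat (Suc n) \<le> prime_height R P'" if n: "n \<in> ?S" for n
  proof -
    obtain Q where "prime_chain R n Q" "Q n = P" using n by auto
    then have "prime_chain R (Suc n) (Q(Suc n := P'))"
      using assms by (auto simp: prime_chain_def le_Suc_eq less_Suc_eq)
    from prime_chain_height[OF this] show ?thesis by simp
  qed
  have "n < k" if "n \<in> ?S" for n
    using ext[OF that] assms(4) order_trans[of "enat (Suc n)" _ "enat k"] by fastforce
  then have fin: "finite ?S" using finite_nat_set_iff_bounded by blast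
  have "prime_chain R 0 (\<lambda>_. P)" using assms(1) by (simp add: prime_chain_def)
  then have ne: "?S \<noteq> {}" by auto
  have "prime_height R P \<le> enat (Max ?S)"
    by (rule prime_height_le) (use fin in \<open>auto intro: Max_ge\<close>)
  also have "enat (Max ?S) < enat (Suc (Max ?S))" by simp
  also have "enat (Suc (Max ?S)) \<le> prime_height R P'" by (rule ext[OF Max_in[OF fin ne]])
  finally show ?thesis .
qed

text \<open>Among the primes over \<open>I\<close> of height at most \<open>k\<close>, one of least
  height is minimal over \<open>I\<close> by strict monotonicity.\<close>

lemma minimal_prime_below:
  assumes "primeideal P R" "I \<subseteq> P" "prime_height R P \<le> enat k"
  shows "\<exists>Q. minimal_prime R I Q \<and> prime_height R Q \<le> enat k"
proof -
  let ?X = "{Q. primeideal Q R \<and> I \<subseteq> Q \<and> prime_height R Q \<le> enat k}"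
  define h where "h = (LEAST h. \<exists>Q\<in>?X. prime_height R Q = h)"
  have "\<exists>Q\<in>?X. prime_height R Q = prime_height R P" using assms by blast
  then have "\<exists>Q\<in>?X. prime_height R Q = h" unfolding h_def by (rule LeastI)
  then obtain Q where Q: "Q \<in> ?X" "prime_height R Q = h" by blast
  have "Q' = Q" if Q': "primeideal Q' R" "I \<subseteq> Q'" "Q' \<subseteq> Q" for Q'
  proof (rule ccontr)
    assume "Q' \<noteq> Q"
    then have lt: "prime_height R Q' < prime_height R Q"
      using prime_height_strict_mono[of Q' R Q k] Q Q' by auto
    then have "Q' \<in> ?X" using Q Q' by auto
    then have "h \<le> prime_height R Q'" unfolding h_def by (intro Least_le) auto
    then show False using lt Q(2) by auto
  qed
  then show ?thesis using Q unfolding minimal_prime_def by blast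
qed

section \<open>Cosets, primes and regular sequences in quotient rings\<close>

lemma a_r_coset_poly: "I +>\<^bsub>poly_ring V\<^esub> x = {p. \<exists>j\<in>I. p = j + x}"
  by (auto simp: a_r_coset_def r_coset_def)

lemma coset_eq_iff:
  assumes "poly_ideal V I"
  shows "I +>\<^bsub>poly_ring V\<^esub> x = I +>\<^bsub>poly_ring V\<^esub> y \<longleftrightarrow> x - y \<in> I"
proof
  assume eq: "I +>\<^bsub>poly_ring V\<^esub> x = I +>\<^bsub>poly_ring V\<^esub> y"
  have "x = 0 + x" by simp
  then have "x \<in> I +>\<^bsub>poly_ring V\<^esub> x" unfolding a_r_coset_poly using poly_idealD(2)[OF assms] by blast
  then have "x \<in> I +>\<^bsub>poly_ring V\<^esub> y" unfolding eq .
  then show "x - y \<in> I" by (auto simp: a_r_coset_poly)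
next
  assume xy: "x - y \<in> I"
  then have yx: "y - x \<in> I" using poly_ideal_uminus[OF assms xy] by simp
  have "j + x = (j + (x - y)) + y" "j + y = (j + (y - x)) + x" for j by simp_all
  then show "I +>\<^bsub>poly_ring V\<^esub> x = I +>\<^bsub>poly_ring V\<^esub> y"
    unfolding a_r_coset_poly using poly_idealD(3)[OF assms _ xy] poly_idealD(3)[OF assms _ yx]
    by blast
qed

text \<open>An ideal \<open>J\<close> containing \<open>I\<close> is a union of cosets of
  \<open>I\<close>.\<close>

lemma mem_coset_image_iff:
  assumes "poly_ideal V I" "poly_ideal V J" "I \<subseteq> J"
  shows "I +>\<^bsub>poly_ring V\<^esub> x \<in> (+>\<^bsub>poly_ring V\<^esub>) I ` J \<longleftrightarrow> x \<in> J"
proof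
  assume "I +>\<^bsub>poly_ring V\<^esub> x \<in> (+>\<^bsub>poly_ring V\<^esub>) I ` J"
  then obtain y where "y \<in> J" "x - y \<in> I" by (auto simp: coset_eq_iff[OF assms(1)])
  then show "x \<in> J" using poly_ideal_cong[OF assms(2), of x y] assms(3) by auto
qed auto

lemma carrier_quot: "carrier (poly_ring V Quot I) = (+>\<^bsub>poly_ring V\<^esub>) I ` polys V"
  unfolding FactRing_def A_RCOSETS_def RCOSETS_def a_r_coset_def by auto

context
  fixes V :: "point set" and I :: "'k::field mpoly set"
  assumes I: "poly_ideal V I"
begin

interpretation S: cring "poly_ring V :: 'k mpoly ring" by (rule poly_ring_cring)
interpretation I: ideal I "poly_ring V" using I by (simp add: ideal_iff_poly_ideal)
interpretation R: cring "poly_ring V Quot I" by (rule I.quotient_is_cring[OF poly_ring_cring])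
interpretation h: ring_hom_ring "poly_ring V" "poly_ring V Quot I" "(+>\<^bsub>poly_ring V\<^esub>) I"
  by (rule I.rcos_ring_hom_ring)

lemma ideal_quot_image:
  assumes "poly_ideal V J"
  shows "ideal ((+>\<^bsub>poly_ring V\<^esub>) I ` J) (poly_ring V Quot I)"
  using S.ring_ideal_imp_quot_ideal[OF I.is_ideal, of J] assms by (simp add: ideal_iff_poly_ideal)

lemma primeideal_quot_image:
  assumes Q: "primeideal Q (poly_ring V)" "I \<subseteq> Q"
  shows "primeideal ((+>\<^bsub>poly_ring V\<^esub>) I ` Q) (poly_ring V Quot I)"
proof (rule primeidealI[OF ideal_quot_image R.is_cring])
  note QD = primeidealD[OF Q(1)]
  note iff = mem_coset_image_iff[OF I QD(1) Q(2)]
  show "poly_ideal V Q" by (rule QD)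
  show "carrier (poly_ring V Quot I) \<noteq> (+>\<^bsub>poly_ring V\<^esub>) I ` Q"
    using iff[of 1] QD(2) imageI[OF polys_one[of V], of "(+>\<^bsub>poly_ring V\<^esub>) I"]
    unfolding carrier_quot by metis
  fix a b
  assume "a \<in> carrier (poly_ring V Quot I)" "b \<in> carrier (poly_ring V Quot I)"
    and ab: "a \<otimes>\<^bsub>poly_ring V Quot I\<^esub> b \<in> (+>\<^bsub>poly_ring V\<^esub>) I ` Q"
  then obtain p q where pq: "p \<in> polys V" "q \<in> polys V" "a = I +>\<^bsub>poly_ring V\<^esub> p"
    "b = I +>\<^bsub>poly_ring V\<^esub> q" by (auto simp: carrier_quot)
  then have "p * q \<in> Q" using ab h.hom_mult[of p q] iff[of "p * q"] by simp
  then show "a \<in> (+>\<^bsub>poly_ring V\<^esub>) I ` Q \<or> b \<in> (+>\<^bsub>poly_ring V\<^esub>) I ` Q"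
    using QD(3)[OF pq(1,2)] unfolding pq(3,4) by blast
qed

lemma krull_dim_quot_ge:
  assumes Q: "prime_chain (poly_ring V) n Q" "I \<subseteq> Q 0"
  shows "enat n \<le> krull_dim (poly_ring V Quot I)"
proof -
  have prime: "primeideal (Q i) (poly_ring V)" if "i \<le> n" for i using Q that by (simp add: prime_chain_def)
  have IQ: "I \<subseteq> Q i" if "i \<le> n" for i
    using that
  proof (induction i)
    case (Suc i)
    then have "Q i \<subset> Q (Suc i)" using Q(1) by (simp add: prime_chain_def)
    then show ?case using Suc by auto
  qed (rule Q(2))
  have "(+>\<^bsub>poly_ring V\<^esub>) I ` Q i \<subset> (+>\<^bsub>poly_ring V\<^esub>) I ` Q (Suc i)" if "i < n" for i
  proof -
    have "Q i \<subset> Q (Suc i)" using Q(1) that by (simp add: prime_chain_def)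
    then obtain x where x: "x \<in> Q (Suc i)" "x \<notin> Q i" "Q i \<subseteq> Q (Suc i)" by blast
    have "I +>\<^bsub>poly_ring V\<^esub> x \<notin> (+>\<^bsub>poly_ring V\<^esub>) I ` Q i"
      using mem_coset_image_iff[OF I primeidealD(1)[OF prime] IQ, of i x] x(2) that by simp
    then show ?thesis using x by blast
  qed
  then have "prime_chain (poly_ring V Quot I) n (\<lambda>i. (+>\<^bsub>poly_ring V\<^esub>) I ` Q i)"
    using prime IQ primeideal_quot_image by (simp add: prime_chain_def)
  then show ?thesis unfolding krull_dim_def by (intro Sup_upper) auto
qed

lemma genideal_quot:
  assumes X: "X \<subseteq> polys V"
  shows "genideal (poly_ring V Quot I) ((+>\<^bsub>poly_ring V\<^esub>) I ` X) =
    (+>\<^bsub>poly_ring V\<^esub>) I ` gen V (I \<union> X)"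
proof
  have IX: "I \<union> X \<subseteq> polys V" using X poly_idealD(1)[OF I] by auto
  show "genideal (poly_ring V Quot I) ((+>\<^bsub>poly_ring V\<^esub>) I ` X) \<subseteq> (+>\<^bsub>poly_ring V\<^esub>) I ` gen V (I \<union> X)"
    using gen_superset[of "I \<union> X" V]
    by (intro R.genideal_minimal ideal_quot_image poly_ideal_gen IX) auto
  let ?G = "genideal (poly_ring V Quot I) ((+>\<^bsub>poly_ring V\<^esub>) I ` X)"
  have XR: "(+>\<^bsub>poly_ring V\<^esub>) I ` X \<subseteq> carrier (poly_ring V Quot I)" using X by (auto simp: carrier_quot)
  have G: "ideal ?G (poly_ring V Quot I)" by (rule R.genideal_ideal[OF XR])
  have "poly_ideal V {x \<in> polys V. I +>\<^bsub>poly_ring V\<^esub> x \<in> ?G}"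
    using h.ideal_vimage[OF G] by (simp add: ideal_iff_poly_ideal)
  moreover have "X \<subseteq> {x \<in> polys V. I +>\<^bsub>poly_ring V\<^esub> x \<in> ?G}"
    using X R.genideal_self[OF XR] by auto
  moreover have "I +>\<^bsub>poly_ring V\<^esub> x = \<zero>\<^bsub>poly_ring V Quot I\<^esub>" if "x \<in> I" for x
    using that coset_eq_iff[OF I, of x 0] h.hom_zero by simp
  then have "I \<subseteq> {x \<in> polys V. I +>\<^bsub>poly_ring V\<^esub> x \<in> ?G}"
    using poly_idealD(1)[OF I] additive_subgroup.zero_closed[OF ideal.axioms(1)[OF G]] by auto
  ultimately have "gen V (I \<union> X) \<subseteq> {x \<in> polys V. I +>\<^bsub>poly_ring V\<^esub> x \<in> ?G}"
    by (intro gen_minimal) auto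
  then show "(+>\<^bsub>poly_ring V\<^esub>) I ` gen V (I \<union> X) \<subseteq> ?G" by auto
qed

lemma regular_sequence_quotD:
  assumes "regular_sequence (poly_ring V Quot I) (map ((+>\<^bsub>poly_ring V\<^esub>) I) fs)" "set fs \<subseteq> polys V"
  shows "regseq V I fs"
proof (rule regseqI[OF I assms(2)])
  fix i assume i: "i < length fs"
  let ?X = "set (take i fs)"
  have X: "?X \<subseteq> polys V" using assms(2) set_take_subset[of i fs] by auto
  have IX: "I \<union> ?X \<subseteq> polys V" using X poly_idealD(1)[OF I] by auto
  have f: "fs ! i \<in> polys V" using assms(2) i by auto
  have gen: "genideal (poly_ring V Quot I) (set (take i (map ((+>\<^bsub>poly_ring V\<^esub>) I) fs))) =
    (+>\<^bsub>poly_ring V\<^esub>) I ` gen V (I \<union> ?X)"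
    using genideal_quot[OF X] by (simp add: take_map)
  have iff: "I +>\<^bsub>poly_ring V\<^esub> x \<in> (+>\<^bsub>poly_ring V\<^esub>) I ` gen V (I \<union> ?X) \<longleftrightarrow> x \<in> gen V (I \<union> ?X)" for x
    using gen_superset[of "I \<union> ?X" V] by (intro mem_coset_image_iff[OF I poly_ideal_gen[OF IX]]) auto
  show "regular_mod V (gen V (I \<union> ?X)) (fs ! i)"
    unfolding regular_mod_def
  proof (intro ballI impI)
    fix g assume g: "g \<in> polys V" "fs ! i * g \<in> gen V (I \<union> ?X)"
    have "(I +>\<^bsub>poly_ring V\<^esub> fs ! i) \<otimes>\<^bsub>poly_ring V Quot I\<^esub> (I +>\<^bsub>poly_ring V\<^esub> g) =
        I +>\<^bsub>poly_ring V\<^esub> (fs ! i * g)"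
      using h.hom_mult[OF f g(1)] by simp
    also have "\<dots> \<in> (+>\<^bsub>poly_ring V\<^esub>) I ` gen V (I \<union> ?X)" using g(2) by auto
    finally have "I +>\<^bsub>poly_ring V\<^esub> g \<in> (+>\<^bsub>poly_ring V\<^esub>) I ` gen V (I \<union> ?X)"
      using assms(1) i g(1) unfolding regular_sequence_def gen[symmetric]
      by (auto simp: carrier_quot)
    then show "g \<in> gen V (I \<union> ?X)" unfolding iff .
  qed
qed

end


section \<open>Ideals generated by quadrics\<close>

lemma adj_minor_eq:
  "adj_minor i j = Poly_Mapping.single (Poly_Mapping.single (i, j) 1 + Poly_Mapping.single (i + 1, j + 1) 1) 1 -
    Poly_Mapping.single (Poly_Mapping.single (i, j + 1) 1 + Poly_Mapping.single (i + 1, j) 1) (1 :: 'k::field)"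
  by (simp add: adj_minor_def pvar_def mult_single)

lemma mon_degree_single [simp]: "mon_degree (Poly_Mapping.single v n) = n"
  by (simp add: mon_degree_def)

lemma adj_minor_degree: "m \<in> Poly_Mapping.keys (adj_minor i j :: 'k::field mpoly) \<Longrightarrow> mon_degree m = 2"
  unfolding adj_minor_eq by (auto simp: in_keys_iff lookup_minus lookup_single when_def mon_degree_add split: if_splits)

lemma minors_hom:
  "f \<in> minors D \<Longrightarrow> \<forall>m\<in>Poly_Mapping.keys f. mon_degree m = 2"
  using adj_minor_degree by (auto simp: minors_def)

text \<open>The diagonal monomial of a cell determines the cell and is never the anti-diagonal
  monomial of a cell. These coefficients therefore separate the minors.\<close>

lemma lookup_adj_minor:
  "Poly_Mapping.lookup (adj_minor i j :: 'k::field mpoly)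
     (Poly_Mapping.single (k, l) 1 + Poly_Mapping.single (k + 1, l + 1) 1) = (if (i, j) = (k, l) then 1 else 0)"
proof -
  let ?m = "\<lambda>u v. Poly_Mapping.single u 1 + Poly_Mapping.single v (1::nat) :: point \<Rightarrow>\<^sub>0 nat"
  have keys: "Poly_Mapping.keys (?m u v) = {u, v}" for u v by (auto simp: keys_add_nat)
  have 1: "?m (i, j) (i + 1, j + 1) = ?m (k, l) (k + 1, l + 1) \<longleftrightarrow> (i, j) = (k, l)"
  proof
    assume "?m (i, j) (i + 1, j + 1) = ?m (k, l) (k + 1, l + 1)"
    then have "{(i, j), (i + 1, j + 1)} = {(k, l), (k + 1, l + 1)}" using keys by metis
    then show "(i, j) = (k, l)" by (auto simp: doubleton_eq_iff)
  qed auto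
  have 2: "?m (i, j + 1) (i + 1, j) \<noteq> ?m (k, l) (k + 1, l + 1)"
  proof
    assume "?m (i, j + 1) (i + 1, j) = ?m (k, l) (k + 1, l + 1)"
    then have "{(i, j + 1), (i + 1, j)} = {(k, l), (k + 1, l + 1)}" using keys by metis
    then show False by (auto simp: doubleton_eq_iff)
  qed
  show ?thesis unfolding adj_minor_eq lookup_minus lookup_single when_def 1 using 2 by simp
qed

lemma lookup_Const_mult: "Poly_Mapping.lookup (Const c * p) m = c * Poly_Mapping.lookup p m"
  unfolding Const_def mult_map_scale_conv_mult[symmetric] by (simp add: map.rep_eq when_def)

lemma minors_independent:
  assumes "finite D"
  shows "mpoly.independent (minors D :: 'k::field mpoly set)" "card (minors D :: 'k mpoly set) = card D"
proof -
  let ?f = "\<lambda>(i, j). adj_minor i j :: 'k mpoly"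
  let ?m = "\<lambda>(k, l). Poly_Mapping.single (k, l) 1 + Poly_Mapping.single (k + 1, l + 1) (1::nat) :: point \<Rightarrow>\<^sub>0 nat"
  have lookup: "Poly_Mapping.lookup (?f c) (?m d) = (if c = d then 1 else 0)" for c d
    using lookup_adj_minor[of "fst c" "snd c" "fst d" "snd d"] by (simp add: case_prod_beta)
  have inj: "inj_on ?f D"
  proof (rule inj_onI)
    fix c d assume "?f c = ?f d"
    then have "Poly_Mapping.lookup (?f c) (?m d) = Poly_Mapping.lookup (?f d) (?m d)" by simp
    then show "c = d" unfolding lookup by (simp split: if_splits)
  qed
  show "card (minors D :: 'k mpoly set) = card D" unfolding minors_def by (rule card_image[OF inj])
  show "mpoly.independent (minors D :: 'k mpoly set)"
  proof (rule mpoly.independent_if_scalars_zero)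
    show "finite (minors D :: 'k mpoly set)" unfolding minors_def using assms by simp
    fix a :: "'k mpoly \<Rightarrow> 'k" and x :: "'k mpoly"
    assume 0: "(\<Sum>x\<in>minors D. Const (a x) * x) = 0" and "x \<in> minors D"
    then obtain d where d: "d \<in> D" "x = ?f d" by (auto simp: minors_def)
    have "(\<Sum>c\<in>D. Const (a (?f c)) * ?f c) = 0"
      using 0 unfolding minors_def by (simp add: sum.reindex[OF inj])
    then have "0 = Poly_Mapping.lookup (\<Sum>c\<in>D. Const (a (?f c)) * ?f c) (?m d)" by simp
    also have "\<dots> = (\<Sum>c\<in>D. a (?f c) * Poly_Mapping.lookup (?f c) (?m d))"
      unfolding lookup_sum by (intro sum.cong refl) (simp only: lookup_Const_mult)
    also have "\<dots> = a (?f d)" unfolding lookup using d(1) assms by (simp add: if_distrib[of "\<lambda>x. _ * x"] cong: if_cong)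
    finally show "a x = 0" using d(2) by simp
  qed
qed

lemma trunc_Suc_0: "trunc (Suc 0) r = Const (Poly_Mapping.lookup r 0)"
proof (rule poly_mapping_eqI)
  fix m
  have "mon_degree m = 0 \<longleftrightarrow> m = 0"
    by (auto simp: mon_degree_def in_keys_iff intro!: poly_mapping_eqI)
  then show "Poly_Mapping.lookup (trunc (Suc 0) r) m = Poly_Mapping.lookup (Const (Poly_Mapping.lookup r 0)) m"
    by (auto simp: lookup_trunc Const_def lookup_single when_def)
qed

text \<open>Only the quadratic parts of the generators contribute to the quadratic part of the ideal.\<close>

lemma card_generators_ge:
  fixes fs :: "'k::field mpoly list"
  assumes D: "finite D" "verts D \<subseteq> V" and fs: "set fs \<subseteq> polys V" "gen V (minors D) = gen V (set fs)"
  shows "card D \<le> length fs"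
proof -
  let ?S = "mpoly.span (trunc 3 ` set fs)"
  let ?Q = "{p \<in> polys V. trunc 2 p = 0} :: 'k mpoly set"
  \<comment> \<open>The polynomials without terms of degree below two whose quadratic part lies in
    the span of those of \<open>fs\<close>. They form an ideal because multiplication by
    \<open>r\<close> scales the quadratic part by the constant term of \<open>r\<close>.\<close>
  let ?J = "{p \<in> ?Q. trunc 3 p \<in> ?S}"
  have quad: "trunc 2 (r * p) = 0 \<and> trunc 3 (r * p) = Const (Poly_Mapping.lookup r 0) * trunc 3 p"
    if "trunc 2 p = 0" for r p :: "'k mpoly"
  proof -
    have deg2: "mon_degree m \<ge> 2" if "m \<in> Poly_Mapping.keys p" for m
      using \<open>trunc 2 p = 0\<close> that keys_trunc[of 2 p] by fastforce
    define q where "q = trunc 3 p"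
    have q: "mon_degree m = 2" if "m \<in> Poly_Mapping.keys q" for m
      using that deg2[of m] by (simp add: q_def keys_trunc)
    have rest: "mon_degree m \<ge> 3" if "m \<in> Poly_Mapping.keys (p - q)" for m
      using that by (auto simp: q_def in_keys_iff lookup_minus lookup_trunc when_def split: if_splits)
    have "mon_degree m \<ge> 3" if "m \<in> Poly_Mapping.keys (r * (p - q))" for m
      using that Poly_Mapping.keys_mult[of r "p - q"] rest by (fastforce simp: mon_degree_add)
    then have 0: "trunc n (r * (p - q)) = 0" if "n \<le> 3" for n
      using that by (intro trunc_eq_0) fastforce
    have "r * p = q * r + r * (p - q)" by (simp add: algebra_simps)
    then have "trunc n (r * p) = q * trunc (n - 2) r" if "n \<le> 3" for n
      using trunc_mult[where d = 2 and n = n and g = r, OF q] 0[OF that] by (simp add: trunc_add)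
    from this[of 2] this[of 3] show ?thesis by (simp add: trunc_Suc_0 q_def mult.commute)
  qed
  have Q: "poly_ideal V ?Q" using quad by (auto simp: poly_ideal_def trunc_add)
  have J: "poly_ideal V ?J"
    using quad by (auto simp: poly_ideal_def trunc_add intro: mpoly.span_add mpoly.span_scale mpoly.span_zero)
  have minors: "trunc 3 f = f" "trunc 2 f = 0" if "f \<in> minors D" for f :: "'k mpoly"
    using minors_hom[OF that] by (auto intro!: trunc_id trunc_eq_0)
  have "gen V (minors D) \<subseteq> ?Q"
    using minors_polys[OF D(2)] minors by (intro gen_minimal[OF Q]) auto
  then have "set fs \<subseteq> ?Q" using fs(2) gen_superset[of "set fs" V] by auto
  then have "set fs \<subseteq> ?J" by (auto intro: mpoly.span_base)
  then have "minors D \<subseteq> ?J"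
    using gen_minimal[OF J] fs(2) gen_superset[of "minors D" V] by blast
  then have "minors D \<subseteq> ?S" using minors by fastforce
  then have "card (minors D :: 'k mpoly set) \<le> card (trunc 3 ` set fs)"
    using minors_independent(1)[OF D(1)] by (intro mpoly.independent_span_bound[THEN conjunct2]) auto
  also have "\<dots> \<le> length fs" using card_image_le[of "set fs" "trunc 3"] card_length[of fs] by simp
  finally show ?thesis using minors_independent(2)[OF D(1)] by metis
qed


section \<open>A component of small codimension\<close>

lemma vertsI: "(i, j) \<in> D \<Longrightarrow> v \<in> cell i j \<Longrightarrow> v \<in> verts D"
  by (auto simp: verts_def)

text \<open>In the column of the centre of the square tetromino take the maximal run of vertices through
  the centre such that any two consecutive ones are joined by an edge of a cell. Setting
  all of them to zero kills the minors of all cells that meet the run. There are more such cells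
  than vertices, since the two rows at the centre contain two of them each.\<close>

lemma column_run:
  fixes a b :: int
  assumes D: "finite D" "(a - 1, b - 1) \<in> D" "(a - 1, b) \<in> D" "(a, b - 1) \<in> D" "(a, b) \<in> D"
  shows "\<exists>Z D'. finite Z \<and> D' \<subseteq> D \<and> Z \<subseteq> verts D \<and> Z \<inter> verts D' = {} \<and>
    card Z + card D' < card D \<and>
    (\<forall>(i, j)\<in>D - D'. ((i, j) \<in> Z \<or> (i + 1, j + 1) \<in> Z) \<and> ((i, j + 1) \<in> Z \<or> (i + 1, j) \<in> Z))"
proof -
  \<comment> \<open>\<open>R j\<close> says that the edge from \<open>(a, j)\<close> to
    \<open>(a, j + 1)\<close> belongs to a cell of \<open>D\<close>.\<close>
  define R where "R j \<longleftrightarrow> (a - 1, j) \<in> D \<or> (a, j) \<in> D" for j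
  have ex: "\<exists>n. \<not> R (g n)" if "inj g" for g :: "nat \<Rightarrow> int"
  proof (rule ccontr)
    assume "\<not> ?thesis"
    then have "g ` UNIV \<subseteq> snd ` D" unfolding R_def by force
    then have "finite (range g)" using D(1) finite_subset by blast
    then show False using that finite_imageD by blast
  qed
  \<comment> \<open>The run extends \<open>p\<close> edges upwards and, below, \<open>q\<close>
    edges downwards from the centre; both are finite since \<open>D\<close> is.\<close>
  obtain p where p: "\<not> R (b + int p)" "\<And>n. n < p \<Longrightarrow> R (b + int n)"
    using ex[of "\<lambda>n. b + int n"] exists_least_iff[of "\<lambda>n. \<not> R (b + int n)"] by (auto simp: inj_def)
  obtain q where q: "\<not> R (b - 1 - int q)" "\<And>n. n < q \<Longrightarrow> R (b - 1 - int n)"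
    using ex[of "\<lambda>n. b - 1 - int n"] exists_least_iff[of "\<lambda>n. \<not> R (b - 1 - int n)"]
    by (auto simp: inj_def)
  have "p \<noteq> 0" using p(1) D(5) by (auto simp: R_def intro: gr0I)
  have "q \<noteq> 0" using q(1) D(4) by (auto simp: R_def intro: gr0I)
  define s t where "s = b - int q" and "t = b + int p"
  have st: "s < b" "b < t" using \<open>p \<noteq> 0\<close> \<open>q \<noteq> 0\<close> by (simp_all add: s_def t_def)
  have R: "R j" if "s \<le> j" "j < t" for j
  proof (cases "b \<le> j")
    case True
    then show ?thesis using p(2)[of "nat (j - b)"] that by (simp add: t_def)
  next
    case False
    then show ?thesis using q(2)[of "nat (b - 1 - j)"] that by (simp add: s_def)
  qed
  have nR: "\<not> R (s - 1)" "\<not> R t" using p(1) q(1) by (simp_all add: s_def t_def algebra_simps)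
  define Z where "Z = Pair a ` {s..t}"
  define K where "K = {(i, j) \<in> D. (i = a - 1 \<or> i = a) \<and> s \<le> j \<and> j < t}"
  define D' where "D' = D - K"
  have "K \<subseteq> D" by (auto simp: K_def)
  with D(1) have K: "finite K" "K \<subseteq> D" by (simp_all add: finite_subset)
  have cardZ: "card Z = nat (t + 1 - s)" unfolding Z_def by (subst card_image) (auto simp: inj_on_def)
  \<comment> \<open>One cell for each of the \<open>t - s\<close> edges, on the right-hand side if
    possible. At rows \<open>b - 1\<close> and \<open>b\<close> the left-hand cells are then left
    over, which gives \<open>t - s + 2\<close> cells against \<open>t - s + 1\<close>
    vertices.\<close>
  define f where "f j = (if (a, j) \<in> D then (a, j) else (a - 1, j))" for j
  have fK: "f j \<in> K" if "s \<le> j" "j < t" for j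
    using R[OF that] that by (auto simp: f_def K_def R_def)
  have "f ` {s..<t} \<union> {(a - 1, b), (a - 1, b - 1)} \<subseteq> K"
  proof -
    have "f ` {s..<t} \<subseteq> K" using fK by auto
    moreover have "{(a - 1, b), (a - 1, b - 1)} \<subseteq> K" using D st by (auto simp: K_def)
    ultimately show ?thesis by simp
  qed
  then have "card (f ` {s..<t} \<union> {(a - 1, b), (a - 1, b - 1)}) \<le> card K" using K(1) by (rule card_mono[rotated])
  also have "card (f ` {s..<t} \<union> {(a - 1, b), (a - 1, b - 1)}) =
      card (f ` {s..<t}) + card {(a - 1, b), (a - 1, b - 1)}"
  proof (rule card_Un_disjoint)
    have "(a - 1, b) \<notin> f ` {s..<t}" "(a - 1, b - 1) \<notin> f ` {s..<t}"
      using D(4,5) by (auto simp: f_def split: if_splits)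
    then show "f ` {s..<t} \<inter> {(a - 1, b), (a - 1, b - 1)} = {}"
      by - (subst Int_insert_right_if0, assumption, subst Int_insert_right_if0, assumption, rule Int_empty_right)
  qed auto
  also have "card (f ` {s..<t}) = nat (t - s)"
    by (subst card_image) (auto simp: inj_on_def f_def split: if_splits)
  finally have "nat (t - s) + 2 \<le> card K" by simp
  moreover have "card D' = card D - card K" "card K \<le> card D"
    unfolding D'_def using K D(1) by (auto simp: card_Diff_subset card_mono)
  ultimately have card: "card Z + card D' < card D" using cardZ st by linarith
  have "Z \<subseteq> verts D"
  proof
    fix v assume "v \<in> Z"
    then obtain j where j: "v = (a, j)" "s \<le> j" "j \<le> t" by (auto simp: Z_def)
    show "v \<in> verts D"
    proof (cases "j < t")
      case True
      then have "(a - 1, j) \<in> D \<or> (a, j) \<in> D" using R j by (simp add: R_def)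
      then show ?thesis by (elim disjE) (rule vertsI, assumption, simp add: cell_def j)+
    next
      case False
      then have "(a - 1, j - 1) \<in> D \<or> (a, j - 1) \<in> D" using R[of "j - 1"] j st by (simp add: R_def)
      then show ?thesis by (elim disjE) (rule vertsI, assumption, simp add: cell_def j)+
    qed
  qed
  moreover have "Z \<inter> verts D' = {}"
  proof -
    have False if "(i, j) \<in> D'" "v \<in> cell i j" "v \<in> Z" for i j v
    proof -
      \<comment> \<open>A cell meeting the run lies in one of the rows \<open>s - 1\<close> to
        \<open>t\<close>, and the two outer rows are excluded by maximality of the run.\<close>
      have "i = a - 1 \<or> i = a" "s - 1 \<le> j" "j \<le> t" using that by (auto simp: cell_def Z_def)
      moreover from this have "R j" using that(1) by (auto simp: R_def D'_def)
      then have "j \<noteq> s - 1" "j \<noteq> t" using nR by auto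
      ultimately have "(i, j) \<in> K" using that(1) by (auto simp: K_def D'_def)
      then show False using that(1) by (simp add: D'_def)
    qed
    then show ?thesis by (auto simp: verts_def)
  qed
  moreover have "\<forall>(i, j)\<in>D - D'. ((i, j) \<in> Z \<or> (i + 1, j + 1) \<in> Z) \<and> ((i, j + 1) \<in> Z \<or> (i + 1, j) \<in> Z)"
    by (auto simp: D'_def K_def Z_def)
  moreover have "finite Z" by (simp add: Z_def)
  moreover have "D' \<subseteq> D" by (auto simp: D'_def)
  ultimately show ?thesis using card by blast
qed

text \<open>\<open>Q 0\<close> is the kernel at a point that vanishes on \<open>Z\<close> and is
  generic for the remaining cells \<open>D'\<close>. Its free variables are used twice: specializing
  them gives the chain above \<open>Q 0\<close>, and they are independent modulo
  \<open>Q 0\<close>.\<close>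

lemma small_component:
  fixes a b :: int
  assumes D: "finite D" "(a - 1, b - 1) \<in> D" "(a - 1, b) \<in> D" "(a, b - 1) \<in> D" "(a, b) \<in> D"
    and V: "V = verts D" "finite V"
  shows "\<exists>N Q ts. card V < N + card D \<and> prime_chain (poly_ring V) N Q \<and>
    gen V (minors D) \<subseteq> Q 0 \<and> length ts = N \<and> set ts \<subseteq> polys V \<and>
    indep (Q 0) (ts :: 'k::field mpoly list)"
proof -
  obtain Z D' where Z: "finite Z" "D' \<subseteq> D" "Z \<subseteq> verts D" "Z \<inter> verts D' = {}"
    "card Z + card D' < card D"
    "\<forall>(i, j)\<in>D - D'. ((i, j) \<in> Z \<or> (i + 1, j + 1) \<in> Z) \<and> ((i, j + 1) \<in> Z \<or> (i + 1, j) \<in> Z)"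
    using column_run[OF D] by blast
  have D': "finite D'" "verts D' \<subseteq> V" using Z(2) D(1) finite_subset V(1) by (auto simp: verts_def)
  have lead: "lead D' \<subseteq> V" "lead D' \<inter> Z = {}" "finite (lead D')" "card (lead D') \<le> card D'"
    using lead_subset_verts[of D'] D' Z(4) by (auto simp: lead_def card_image_le)
  obtain us where us: "distinct us" "set us = V - Z - lead D'"
    using finite_distinct_list[of "V - Z - lead D'"] V(2) by auto
  have "length us = card (V - Z - lead D')" using distinct_card[OF us(1)] us(2) by simp
  also have "card (V - Z - lead D') = card V - card Z - card (lead D')"
    using Z(1,3) V lead by (subst card_Diff_subset; auto simp: card_Diff_subset)+
  finally have N: "card V < length us + card D" using Z(5) lead(4) by linarith
  have "\<exists>w. solves D' w \<and> (\<forall>v. v \<notin> lead D' \<longrightarrow> w v = to_fract (spec Z (set (take n us)) v :: 'k mpoly))" for n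
    using Z(4) by (intro solves_exists[OF D'(1)]) (auto simp: spec_def)
  then obtain w :: "nat \<Rightarrow> point \<Rightarrow> 'k mpoly fract" where w: "\<And>n. solves D' (w n)"
    "\<And>n v. v \<notin> lead D' \<Longrightarrow> w n v = to_fract (spec Z (set (take n us)) v)"
    by metis
  have chain: "prime_chain (poly_ring V) (length us) (\<lambda>n. ker V (w n))"
    by (rule spec_chain[OF D' us(1) _ w]) (use us(2) in auto)
  have zero: "w 0 v = 0" if "v \<in> Z" for v using that w(2)[of v 0] lead(2) by (auto simp: spec_def)
  have "gen V (minors D) \<subseteq> ker V (w 0)"
  proof (rule gen_minimal[OF ker_ideal], rule subsetI)
    fix f :: "'k mpoly" assume "f \<in> minors D"
    then obtain i j where ij: "(i, j) \<in> D" "f = adj_minor i j" by (auto simp: minors_def)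
    have "w 0 (i, j) * w 0 (i + 1, j + 1) = w 0 (i, j + 1) * w 0 (i + 1, j)"
    proof (cases "(i, j) \<in> D'")
      case True
      then show ?thesis using w(1)[of 0] by (auto simp: solves_def)
    next
      \<comment> \<open>Both products of such a minor have a factor in \<open>Z\<close>.\<close>
      case False
      then have "((i, j) \<in> Z \<or> (i + 1, j + 1) \<in> Z) \<and> ((i, j + 1) \<in> Z \<or> (i + 1, j) \<in> Z)"
        using Z(6) ij(1) by auto
      then show ?thesis using zero by auto
    qed
    then have "fev (w 0) f = 0" by (simp add: ij adj_minor_def F.ev_diff F.ev_mult)
    moreover have "f \<in> polys V" using minors_polys[of D V] \<open>f \<in> minors D\<close> V(1) by auto
    ultimately show "f \<in> ker V (w 0)" by (simp add: ker_def)
  qed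
  moreover have "indep (ker V (w 0)) (map pvar us)"
  proof (rule indep_pvars[OF us(1)])
    fix p assume p: "p \<in> polys (set us)" "p \<in> ker V (w 0)"
    have "fev (w 0) p = to_fract p"
      by (rule fev_frac_pvar[OF p(1)]) (use us(2) w(2) in \<open>simp add: spec_def\<close>)
    then show "p = 0" using p(2) by (simp add: ker_def)
  qed
  moreover have "set (map pvar us) \<subseteq> polys V" using us(2) by auto
  ultimately show ?thesis using N chain by (intro exI[of _ "length us"] exI[of _ "\<lambda>n. ker V (w n)"] exI[of _ "map pvar us"]) auto
qed


section \<open>Comparison of the two components\<close>

lemma cell_eq_iff: "cell i j = cell k l \<longleftrightarrow> i = k \<and> j = l"
proof
  assume eq: "cell i j = cell k l"
  have "(i, j) \<in> cell k l" unfolding eq[symmetric] by (simp add: cell_def)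
  moreover have "(k, l) \<in> cell i j" unfolding eq by (simp add: cell_def)
  ultimately show "i = k \<and> j = l" by (auto simp: cell_def)
qed simp

context
  fixes D V :: "point set"
  assumes D: "finite D" and V: "V = verts D"
begin

lemma finite_V: "finite V"
  using D by (auto simp: V verts_def cell_def)

lemma poly_ideal_minors: "poly_ideal V (gen V (minors D))"
  by (rule poly_ideal_gen[OF minors_polys]) (simp add: V)

text \<open>The kernel at the generic point for all of \<open>D\<close>. The last clause makes it
  minimal over the ideal of minors and lifts relations modulo \<open>P\<close> to that
  ideal.\<close>

lemma toric_prime_exists:
  "\<exists>(P :: 'k::field mpoly set) Q. prime_chain (poly_ring V) (card D) Q \<and> Q (card D) = P \<and>
     primeideal P (poly_ring V) \<and> gen V (minors D) \<subseteq> P \<and>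
     (\<forall>f\<in>P. \<exists>m\<in>polys V. m \<notin> P \<and> m * f \<in> gen V (minors D))"
proof -
  obtain w where w: "solves D w" "\<forall>v. v \<notin> lead D \<longrightarrow> w v = to_fract (pvar v :: 'k mpoly)"
    using solves_exists[OF D, of "\<lambda>v. to_fract (pvar v)"] by auto
  have DV: "verts D \<subseteq> V" using V by simp
  have w': "w v = to_fract (pvar v)" if "v \<notin> lead D" for v using w(2) that by blast
  obtain Q where Q: "prime_chain (poly_ring V) (card D) Q" "Q (card D) = ker V w"
    using generic_ker_chain[OF D DV w(1) w'] by blast
  have sub: "gen V (minors D) \<subseteq> ker V w"
    by (rule fev_minors[OF _ DV]) (use w(1) in \<open>simp add: solves_def\<close>)
  have ex: "\<exists>m\<in>polys V. m \<notin> ker V w \<and> m * f \<in> gen V (minors D)" if f: "f \<in> ker V w" for f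
  proof -
    obtain m where m: "m \<in> monomials (verts D - lead D)" "m * f \<in> gen V (minors D)"
      using generic_ker[OF D DV w(1) w' f] by blast
    have "fev w m \<noteq> 0" using w(1) by (intro fev_mono_nonzero[OF m(1)]) (simp add: solves_def)
    moreover have "m \<in> polys V" by (rule polys_mono[OF _ monomials_polys[OF m(1)]]) (use V in blast)
    ultimately show ?thesis using m(2) by (intro bexI[of _ m]) (simp_all add: ker_def)
  qed
  show ?thesis
    by (intro exI[of _ "ker V w"] exI[of _ Q] conjI ballI Q ker_prime sub ex)
qed

lemma chain_indep_bound:
  assumes "prime_chain (poly_ring V) n Q" "set ts \<subseteq> polys V" "indep (Q n) (ts :: 'k::field mpoly list)"
  shows "n + length ts \<le> card V"
proof -
  obtain gs where gs: "length gs = n + length ts" "set gs \<subseteq> polys V" "indep (Q 0) gs"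
    using indep_prime_chain[OF assms] by blast
  have "primeideal (Q 0) (poly_ring V)" using assms(1) by (simp add: prime_chain_def)
  then have "0 \<in> Q 0" by (rule poly_idealD(2)[OF primeidealD(1)])
  then have "indep {0} gs" by (intro indep_antimono[OF gs(3)]) simp
  from indep_length[OF this gs(2) finite_V] gs(1) show ?thesis by simp
qed

text \<open>A regular sequence generating the ideal, followed by \<open>ts\<close>, is independent
  modulo zero, and it has at least as many members as there are linearly independent
  quadrics.\<close>

lemma complete_intersection_bound:
  assumes ci: "complete_intersection (poly_ring V) (gen V (minors D :: 'k::field mpoly set))"
    and ts: "set ts \<subseteq> polys V" "indep (gen V (minors D)) (ts :: 'k mpoly list)"
  shows "card D + length ts \<le> card V"
proof -
  obtain fs :: "'k mpoly list" where fs: "regular_sequence (poly_ring V) fs"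
    "gen V (minors D) = gen V (set fs)"
    using ci unfolding complete_intersection_def by blast
  have fsV: "set fs \<subseteq> polys V" using fs(1) by (simp add: regular_sequence_def)
  have gen0: "gen V ({0} \<union> X) = gen V X" if "X \<subseteq> polys V" for X :: "'k mpoly set"
  proof
    show "gen V ({0} \<union> X) \<subseteq> gen V X"
      using poly_idealD(2)[OF poly_ideal_gen[OF that]] gen_superset[of X V]
      by (intro gen_minimal poly_ideal_gen that) auto
  qed (auto intro!: gen_mono)
  have "regseq V {0} fs"
  proof (rule regseqI[OF poly_ideal_zero fsV])
    fix i assume i: "i < length fs"
    have "set (take i fs) \<subseteq> polys V" using fsV set_take_subset[of i fs] by blast
    note gen0 = gen0[OF this]
    show "regular_mod V (gen V ({0} \<union> set (take i fs))) (fs ! i)"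
      using fs(1) i unfolding regular_sequence_def regular_mod_def gen0 by simp
  qed
  moreover have "indep (gen V ({0} \<union> set fs)) ts"
    using ts(2) unfolding fs(2) gen0[OF fsV] .
  ultimately have "indep {0} (fs @ ts)"
    by (rule indep_regseq[OF poly_ideal_zero fsV ts(1)])
  then have "length (fs @ ts) \<le> card V"
    by (rule indep_length) (use fsV ts(1) finite_V in simp_all)
  moreover have "card D \<le> length fs" by (rule card_generators_ge[OF D _ fsV fs(2)]) (simp add: V)
  ultimately show ?thesis by simp
qed

text \<open>A relation of the sequence modulo \<open>P\<close>, multiplied by a suitable
  \<open>m\<close> outside \<open>P\<close>, holds modulo the ideal;
  \<open>homogeneous_regseq_relation\<close> then puts \<open>m\<close> into the ideal and hence
  into \<open>P\<close>. So the sequence is independent modulo \<open>P\<close>, which ends a chain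
  of length \<open>card D\<close>.\<close>

lemma graded_depth_bound:
  "graded_depth V (gen V (minors D) :: 'k::field mpoly set) \<le> enat (card V - card D)"
  unfolding graded_depth_def
proof (rule Sup_least)
  let ?I = "gen V (minors D) :: 'k mpoly set"
  fix x assume "x \<in> {enat (length fs) | fs. regular_sequence (poly_ring V Quot ?I) fs \<and>
    set fs \<subseteq> (\<Union>d\<in>{0<..}. quotient_part V ?I d)}"
  then obtain fs where x: "x = enat (length fs)" and fs: "regular_sequence (poly_ring V Quot ?I) fs"
    "set fs \<subseteq> (\<Union>d\<in>{0<..}. quotient_part V ?I d)" by blast
  let ?H = "\<Union>d\<in>{0<..}. homogeneous_part V d :: 'k mpoly set"
  have "set fs \<subseteq> (+>\<^bsub>poly_ring V\<^esub>) ?I ` ?H" using fs(2) unfolding quotient_part_def image_UN .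
  \<comment> \<open>Homogeneous representatives are chosen for all cosets of the sequence at
    once.\<close>
  then have "fs \<in> lists ((+>\<^bsub>poly_ring V\<^esub>) ?I ` ?H)" by (simp only: in_lists_conv_set subset_iff) simp
  then obtain gs where gs: "set gs \<subseteq> ?H" "fs = map ((+>\<^bsub>poly_ring V\<^esub>) ?I) gs"
    unfolding lists_image by (auto simp only: in_lists_conv_set image_iff subset_iff)
  have gsV: "set gs \<subseteq> polys V" using gs(1) by (auto simp: homogeneous_part_def)
  have hom: "\<exists>d>0. \<forall>m\<in>Poly_Mapping.keys g. mon_degree m = d" if g: "g \<in> set gs" for g
  proof -
    obtain d where d: "0 < d" "g \<in> homogeneous_part V d" using gs(1) g by auto
    then have "\<forall>m\<in>Poly_Mapping.keys g. mon_degree m = nat d" by (auto simp: homogeneous_part_def)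
    then show ?thesis using d(1) by (intro exI[of _ "nat d"]) simp
  qed
  have reg: "regseq V ?I gs"
    using fs(1) gsV unfolding gs(2) by (rule regular_sequence_quotD[OF poly_ideal_minors])
  have graded: "graded ?I"
  proof (rule graded_gen_finite)
    show "finite (minors D :: 'k mpoly set)" using D by (simp add: minors_def)
    show "minors D \<subseteq> polys V" by (rule minors_polys) (simp add: V)
  qed (use minors_hom in blast)
  obtain P :: "'k mpoly set" and Q where P: "prime_chain (poly_ring V) (card D) Q" "Q (card D) = P"
    "?I \<subseteq> P" "\<forall>f\<in>P. \<exists>m\<in>polys V. m \<notin> P \<and> m * f \<in> ?I"
    using toric_prime_exists by blast
  have "indep P gs"
    unfolding indep_def
  proof (intro allI impI, rule ccontr)
    fix A and c :: "nat list \<Rightarrow> 'k"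
    assume A: "finite A" "\<forall>as\<in>A. length as = length gs"
      and rel: "(\<Sum>as\<in>A. Const (c as) * mval gs as) \<in> P" and nz: "\<not> (\<forall>as\<in>A. c as = 0)"
    obtain m where m: "m \<in> polys V" "m \<notin> P" "m * (\<Sum>as\<in>A. Const (c as) * mval gs as) \<in> ?I"
      using bspec[OF P(4) rel] by blast
    have nz': "\<exists>as\<in>A. c as \<noteq> 0" using nz by simp
    have "(\<Sum>as\<in>A. Const (c as) * mval gs as) * m \<in> ?I" by (subst mult.commute) (rule m(3))
    then have "m \<in> ?I"
      by (intro homogeneous_regseq_relation[OF poly_ideal_minors graded gsV reg _ A nz' m(1)] hom)
    then show False using m(2) P(3) by blast
  qed
  then have "card D + length gs \<le> card V" using chain_indep_bound[OF P(1) gsV] P(2) by simp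
  then show "x \<le> enat (card V - card D)" by (simp add: x gs(2))
qed

end

theorem lemma3p2:
  fixes \<C> :: "point set set" and I :: "'k::field mpoly set"
  assumes "finite \<C>" and "\<C> \<noteq> {}" and "\<forall>C\<in>\<C>. is_cell C" and "weakly_connected \<C>"
    and "I = adj_ideal \<C>"
    and "complete_intersection (poly_ring (vertices \<C>)) I \<or>
         gorenstein (vertices \<C>) I \<or>
         level (vertices \<C>) I \<or>
         cohen_macaulay (vertices \<C>) I \<or>
         unmixed (poly_ring (vertices \<C>)) I"
  shows "\<not> (\<exists>T. square_tetromino T \<and> T \<subseteq> \<C>)"
proof
  assume "\<exists>T. square_tetromino T \<and> T \<subseteq> \<C>"
  then obtain v where v: "{C. is_cell C \<and> v \<in> C} \<subseteq> \<C>" unfolding square_tetromino_def by blast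
  obtain a b where "v = (a, b)" by (cases v)
  with v have T: "{C. is_cell C \<and> (a, b) \<in> C} \<subseteq> \<C>" by simp
  define D where "D = {(i, j). cell i j \<in> \<C>}"
  define V where "V = verts D"
  have D: "finite D"
  proof -
    have "inj (\<lambda>(i, j). cell i j)" by (auto simp: inj_def cell_eq_iff)
    then have "finite ((\<lambda>(i, j). cell i j) -` \<C>)" by (rule finite_vimageI[OF assms(1)])
    also have "(\<lambda>(i, j). cell i j) -` \<C> = D" by (auto simp: D_def)
    finally show ?thesis .
  qed
  have "\<C> = (\<lambda>(i, j). cell i j) ` D"
  proof (intro subset_antisym subsetI)
    fix C assume C: "C \<in> \<C>"
    then obtain i j where ij: "C = cell i j" using assms(3) by (auto simp: is_cell_def)
    show "C \<in> (\<lambda>(i, j). cell i j) ` D"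
      by (rule image_eqI[of _ _ "(i, j)"]) (use C ij in \<open>simp_all add: D_def\<close>)
  qed (auto simp: D_def)
  then have V: "vertices \<C> = V" by (simp add: vertices_def V_def verts_def)
  have I: "I = gen V (minors D)"
    unfolding assms(5) adj_ideal_def V minors_def
    by (rule arg_cong[where f = "gen V"]) (auto simp: D_def)
  have "(i, j) \<in> D" if "(a, b) \<in> cell i j" for i j
    using T that unfolding D_def is_cell_def by blast
  then have abD: "(a - 1, b - 1) \<in> D" "(a - 1, b) \<in> D" "(a, b - 1) \<in> D" "(a, b) \<in> D"
    by (simp_all add: cell_def)
  obtain N Q and ts :: "'k mpoly list" where N: "card V < N + card D" "length ts = N"
    and Q: "prime_chain (poly_ring V) N Q" "I \<subseteq> Q 0"
    and ts: "set ts \<subseteq> polys V" "indep (Q 0) ts"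
    using small_component[OF D abD V_def finite_V[OF D V_def]] unfolding I by blast
  note bound = chain_indep_bound[OF D V_def]
  obtain P :: "'k mpoly set" and R where R: "prime_chain (poly_ring V) (card D) R" "R (card D) = P"
    and P: "primeideal P (poly_ring V)" "I \<subseteq> P" "\<forall>f\<in>P. \<exists>m\<in>polys V. m \<notin> P \<and> m * f \<in> I"
    using toric_prime_exists[OF D V_def] unfolding I by blast
  \<comment> \<open>Gorenstein and level quotients are Cohen-Macaulay by definition, so three cases
    remain.\<close>
  from assms(6) consider "complete_intersection (poly_ring V) I" | "cohen_macaulay V I" |
    "unmixed (poly_ring V) I"
    unfolding V gorenstein_def level_def by argo
  then show False
  proof cases
    case 1
    have "indep I ts" by (rule indep_antimono[OF ts(2) Q(2)])
    then have "card D + length ts \<le> card V"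
      using 1 unfolding I by (intro complete_intersection_bound[OF D V_def _ ts(1)])
    then show False using N by simp
  next
    case 2
    have "poly_ideal V I" unfolding I by (rule poly_ideal_minors[OF D V_def])
    then have "enat N \<le> krull_dim (poly_ring V Quot I)" by (rule krull_dim_quot_ge[OF _ Q])
    also have "\<dots> = graded_depth V I" using 2 by (simp add: cohen_macaulay_def)
    also have "\<dots> \<le> enat (card V - card D)" unfolding I by (rule graded_depth_bound[OF D V_def])
    finally have "N \<le> card V - card D" by simp
    \<comment> \<open>A proper ideal contains no nonzero constant. The chain below \<open>P\<close>
      alone then gives \<open>card D \<le> card V\<close>, so the subtraction above is not
      truncated.\<close>
    moreover have "indep P []"
      unfolding indep_def
    proof (intro allI impI ballI, rule ccontr)
      fix A and c :: "nat list \<Rightarrow> 'k" and as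
      assume A: "\<forall>as\<in>A. length as = length ([] :: 'k mpoly list)" "as \<in> A" "c as \<noteq> 0"
        and rel: "(\<Sum>as\<in>A. Const (c as) * mval [] as) \<in> P"
      have "A = {[]}" using A(1,2) by auto
      then have c: "Const (c []) \<in> P" "c [] \<noteq> 0" using A(2,3) rel by simp_all
      have "Const (inverse (c [])) * Const (c []) \<in> P"
        by (rule poly_idealD(4)[OF primeidealD(1)[OF P(1)] polys_Const c(1)])
      then show False using c(2) primeidealD(2)[OF P(1)] by (simp flip: Const_mult)
    qed
    then have "card D \<le> card V" using bound[OF R(1), of "[]"] R(2) by simp
    ultimately show False using N by linarith
  next
    case 3
    have Q0: "primeideal (Q 0) (poly_ring V)" using Q(1) by (simp add: prime_chain_def)
    \<comment> \<open>The \<open>ts\<close> are independent modulo \<open>Q 0\<close>, so a chain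
      ending there has at most \<open>card V - N\<close> steps, fewer than
      \<open>card D\<close>.\<close>
    have chain: "n + N \<le> card V" if "prime_chain (poly_ring V) n Q'" "Q' n = Q 0" for n Q'
      using bound[OF that(1) ts(1)] that(2) ts(2) N(2) by simp
    have "prime_height (poly_ring V) (Q 0) \<le> enat (card V - N)"
    proof (rule prime_height_le)
      fix n Q' assume "prime_chain (poly_ring V) n Q'" "Q' n = Q 0"
      from chain[OF this] show "n \<le> card V - N" by simp
    qed
    from minimal_prime_below[OF Q0 Q(2) this]
    obtain Q' where Q': "minimal_prime (poly_ring V) I Q'"
      "prime_height (poly_ring V) Q' \<le> enat (card V - N)" by blast
    \<comment> \<open>For \<open>f\<close> in \<open>P\<close> some \<open>m * f\<close> with
      \<open>m\<close> outside \<open>P\<close> lies in \<open>I\<close>, so a prime between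
      \<open>I\<close> and \<open>P\<close> must contain \<open>f\<close>.\<close>
    have "P' = P" if P': "primeideal P' (poly_ring V)" "I \<subseteq> P'" "P' \<subseteq> P" for P'
    proof (rule subset_antisym[OF P'(3)], rule subsetI)
      fix f assume f: "f \<in> P"
      then obtain m where m: "m \<in> polys V" "m \<notin> P" "m * f \<in> I" using bspec[OF P(3) f] by blast
      have "f \<in> polys V" by (rule poly_idealD(1)[OF primeidealD(1)[OF P(1)] f])
      then have "m \<in> P' \<or> f \<in> P'" using m(3) P'(2) by (intro primeidealD(3)[OF P'(1) m(1)]) auto
      then show "f \<in> P'" using m(2) P'(3) by blast
    qed
    then have "minimal_prime (poly_ring V) I P" using P(1,2) unfolding minimal_prime_def by blast
    then have "prime_height (poly_ring V) P = prime_height (poly_ring V) Q'"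
      using 3 Q'(1) unfolding unmixed_def by blast
    then have "enat (card D) \<le> enat (card V - N)"
      using prime_chain_height[OF R(1)] R(2) Q'(2) by (metis order_trans)
    moreover have "N \<le> card V"
      using chain[of 0 Q] Q(1) by (simp add: prime_chain_def)
    ultimately show False using N(1) by simp
  qed
qed

end
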